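(* Let $r\ge 2$ and let $F$ be an $r$-critical graph. Then there exist $c_1>0$ and $n_0$ such that for all $n>n_0$ and all integers $1\le q<c_1 n$ we have $h_F(n,q)=t_F(n,q)$; in fact, more strongly, $\mathcal{H}_F(n,q)\subseteq \mathcal{T}^q_r(n)$.
   Context: A graph $F$ is $r$-critical if $\chi(F)=r+1$ and $F$ contains an edge $e$ with $\chi(F-e)=r$. $\mathrm{ex}(n,F)$ is the maximum number of edges in an $n$-vertex graph with no subgraph isomorphic to $F$. A copy of $F$ in a graph $H$ is a subgraph of $H$ isomorphic to $F$. $h_F(n,q)$ is the minimum number of copies of $F$ in a graph with $n$ vertices and $\mathrm{ex}(n,F)+q$ edges, and $\mathcal{H}_F(n,q)$ is the set of graphs with $n$ vertices and $\mathrm{ex}(n,F)+q$ edges attaining this minimum. $t_F(n,q)$ is the smallest number of copies of $F$ in a graph obtained by adding $q$ edges to a maximum $F$-free graph on $n$ vertices. $T_r(n)$ is the Turán graph (complete $r$-partite graph on $n$ vertices with parts of sizes $\lfloor n/r\rfloor$ or $\lceil n/r\rceil$), and $\mathcal{T}^q_r(n)$ is the set of graphs obtained from $T_r(n)$ by adding $q$ edges. *)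

theory Defs
  imports Complex_Main
begin

text \<open>Finite simple graphs are pairs (V, E) with E a set of 2-element subsets of V.
  Host graphs on n vertices have vertex set {0..<n} and are given by their edge set.\<close>

definition graph :: "'a set \<Rightarrow> 'a set set \<Rightarrow> bool" where
  "graph V E \<longleftrightarrow> finite V \<and> (\<forall>e\<in>E. e \<subseteq> V \<and> card e = 2)"

definition all_edges :: "nat \<Rightarrow> nat set set" where
  "all_edges n = {e. e \<subseteq> {0..<n} \<and> card e = 2}"

definition colorable :: "'a set \<Rightarrow> 'a set set \<Rightarrow> nat \<Rightarrow> bool" where
  "colorable V E k \<longleftrightarrow> (\<exists>c :: 'a \<Rightarrow> nat. (\<forall>v\<in>V. c v < k) \<and>
      (\<forall>e\<in>E. \<forall>x\<in>e. \<forall>y\<in>e. x \<noteq> y \<longrightarrow> c x \<noteq> c y))"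

definition chi :: "'a set \<Rightarrow> 'a set set \<Rightarrow> nat" where
  "chi V E = (LEAST k. colorable V E k)"

definition critical :: "nat \<Rightarrow> 'a set \<Rightarrow> 'a set set \<Rightarrow> bool" where
  "critical r VF EF \<longleftrightarrow> chi VF EF = r + 1 \<and> (\<exists>e\<in>EF. chi VF (EF - {e}) = r)"

definition isomorphic :: "'a set \<Rightarrow> 'a set set \<Rightarrow> 'b set \<Rightarrow> 'b set set \<Rightarrow> bool" where
  "isomorphic VF EF V' E' \<longleftrightarrow> (\<exists>f. bij_betw f VF V' \<and>
      (\<forall>x\<in>VF. \<forall>y\<in>VF. {x, y} \<in> EF \<longleftrightarrow> {f x, f y} \<in> E'))"

definition copies :: "'a set \<Rightarrow> 'a set set \<Rightarrow> nat \<Rightarrow> nat set set \<Rightarrow> (nat set \<times> nat set set) set" where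
  "copies VF EF n E = {(V', E'). V' \<subseteq> {0..<n} \<and> E' \<subseteq> E \<and> (\<forall>e\<in>E'. e \<subseteq> V') \<and>
      isomorphic VF EF V' E'}"

definition num_copies :: "'a set \<Rightarrow> 'a set set \<Rightarrow> nat \<Rightarrow> nat set set \<Rightarrow> nat" where
  "num_copies VF EF n E = card (copies VF EF n E)"

definition F_free :: "'a set \<Rightarrow> 'a set set \<Rightarrow> nat \<Rightarrow> nat set set \<Rightarrow> bool" where
  "F_free VF EF n E \<longleftrightarrow> E \<subseteq> all_edges n \<and> copies VF EF n E = {}"

definition ex :: "nat \<Rightarrow> 'a set \<Rightarrow> 'a set set \<Rightarrow> nat" where
  "ex n VF EF = Max {card E | E. F_free VF EF n E}"

definition hF :: "'a set \<Rightarrow> 'a set set \<Rightarrow> nat \<Rightarrow> nat \<Rightarrow> nat" where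
  "hF VF EF n q = Min {num_copies VF EF n E | E. E \<subseteq> all_edges n \<and> card E = ex n VF EF + q}"

definition HF :: "'a set \<Rightarrow> 'a set set \<Rightarrow> nat \<Rightarrow> nat \<Rightarrow> nat set set set" where
  "HF VF EF n q = {E. E \<subseteq> all_edges n \<and> card E = ex n VF EF + q \<and>
      num_copies VF EF n E = hF VF EF n q}"

definition tF :: "'a set \<Rightarrow> 'a set set \<Rightarrow> nat \<Rightarrow> nat \<Rightarrow> nat" where
  "tF VF EF n q = Min {num_copies VF EF n (E \<union> A) | E A.
      F_free VF EF n E \<and> card E = ex n VF EF \<and> A \<subseteq> all_edges n - E \<and> card A = q}"

text \<open>T^q_r(n): graphs on {0..<n} obtained from (a labelled copy of) the Turan graph T_r(n)
  by adding q edges. A labelled copy of T_r(n) is determined by a part function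
  p : {0..<n} \<rightarrow> {0..<r} with part sizes floor(n/r) or ceiling(n/r); its edges are the
  pairs joining different parts.\<close>
definition balanced_partition :: "nat \<Rightarrow> nat \<Rightarrow> (nat \<Rightarrow> nat) \<Rightarrow> bool" where
  "balanced_partition r n p \<longleftrightarrow> (\<forall>v<n. p v < r) \<and>
      (\<forall>i<r. card {v. v < n \<and> p v = i} \<in> {n div r, (n + r - 1) div r})"

definition turan_edges :: "nat \<Rightarrow> (nat \<Rightarrow> nat) \<Rightarrow> nat set set" where
  "turan_edges n p = {e \<in> all_edges n. \<forall>x\<in>e. \<forall>y\<in>e. x \<noteq> y \<longrightarrow> p x \<noteq> p y}"

definition Tq :: "nat \<Rightarrow> nat \<Rightarrow> nat \<Rightarrow> nat set set set" where
  "Tq r n q = {E. \<exists>p A. balanced_partition r n p \<and> A \<subseteq> all_edges n - turan_edges n p \<and>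
      card A = q \<and> E = turan_edges n p \<union> A}"

end

theory Submission
  imports Defs "HOL-Library.FuncSet"
begin

text \<open>
  Let f be the number of vertices of F, and call an edge bad for a partition of the host graph
  into r parts if it lies inside a part. A graph with at least as many edges as the Turan graph
  and only few copies of F is close to r-partite; this is shown without the regularity or removal
  lemma, by running the degree majorization argument of Erdos and Furedi after discarding the few
  vertices whose neighbourhoods are rich in copies of the relevant r-partite graph.

  Take a minimizer and a partition with the fewest bad edges. It has at most
  O(q n^(f-2)) copies of F, since that many suffice for the Turan graph plus q edges. A vertex of
  linear bad degree would lie in order n^(f-1) copies, too many as q is less than c1 n; so all bad
  degrees are small, most bad edges have endpoints that miss few cross edges, and each of those
  lies in order n^(f-2) copies that use no other bad edge. Hence there are only O(q) bad edges, at
  most eta n of them. Now every bad edge is worth at least kappa n^(f-2) copies, whereas adding a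
  missing cross edge, or moving a vertex without bad edges to a smaller part, creates at most
  O(eta n^(f-2)) copies. As either change pays for the deletion of a bad edge, a minimizer
  contains all cross edges and its partition is balanced.
\<close>

subsection \<open>Homomorphisms from coloured vertex sets\<close>

text \<open>Giving the end u of the critical edge an extra colour turns F into a subgraph of a
  complete (r+1)-partite graph. Homomorphisms of that graph are counted rather than embeddings,
  because they extend class by class and only O(n^(f-1)) of them fail to be injective. The exchanges
  at the end decide how small everything must be. As F is not r-colourable, every copy contains a
  bad edge, and a copy created by an exchange also contains the new cross edge or the moved vertex.
  So it has three vertices in one of at most eta n fixed sets of bounded size, which is where
  n^(f-3) times eta n comes from. To beat this, kappa must not depend on eta: it is computed from
  the part sizes alone. It must also be available for every bad edge, not just for most of them;
  this follows once the number of bad edges, and with it every missing degree, is known to be small.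
  That ex(n,F) is the number of edges of the Turan graph is not presupposed. The structural lemma
  mentions only the Turan number, and its case q = 1 determines ex(n,F).\<close>

definition arcs :: "nat set set \<Rightarrow> nat set \<Rightarrow> nat set \<Rightarrow> (nat \<times> nat) set" where
  "arcs E X Y = {(x, y) \<in> X \<times> Y. {x, y} \<in> E}"

text \<open>Only the vertices of colour less than \<open>k\<close> are mapped, so that the colour classes can be
  peeled off one at a time; all pairs of different colours must go to edges.\<close>

definition part_homs :: "'a set \<Rightarrow> ('a \<Rightarrow> nat) \<Rightarrow> nat set set \<Rightarrow> nat \<Rightarrow> nat set \<Rightarrow> ('a \<Rightarrow> nat) set" where
  "part_homs VF c E k X = {\<phi> \<in> {v \<in> VF. c v < k} \<rightarrow>\<^sub>E X.
     \<forall>v\<in>VF. \<forall>w\<in>VF. c v < k \<and> c w < k \<and> c v \<noteq> c w \<longrightarrow> {\<phi> v, \<phi> w} \<in> E}"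

lemma finite_part_homs: "finite VF \<Longrightarrow> finite X \<Longrightarrow> finite (part_homs VF c E k X)"
  unfolding part_homs_def by (intro finite_subset[OF _ finite_PiE[of "{v \<in> VF. c v < k}" "\<lambda>_. X"]]) auto

lemma part_homs_mono: "X \<subseteq> Y \<Longrightarrow> part_homs VF c E k X \<subseteq> part_homs VF c E k Y"
  unfolding part_homs_def by (auto simp: PiE_iff)

lemma card_part_homs_le:
  assumes "finite VF" "X \<subseteq> {..<n}"
  shows "card (part_homs VF c E k X) \<le> n ^ card {v \<in> VF. c v < k}"
proof -
  have "card (part_homs VF c E k X) \<le> card ({v \<in> VF. c v < k} \<rightarrow>\<^sub>E X)"
    unfolding part_homs_def using assms
    by (intro card_mono finite_PiE) (auto intro: finite_subset)
  also have "\<dots> = card X ^ card {v \<in> VF. c v < k}"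
    using assms by (simp add: card_PiE)
  also have "\<dots> \<le> n ^ card {v \<in> VF. c v < k}"
    using card_mono[OF _ assms(2)] by (intro power_mono) auto
  finally show ?thesis .
qed

text \<open>Vertices of colour \<open>k\<close> impose no condition on one another, so their images
  can be chosen independently among the common neighbours \<open>N \<psi>\<close> of the vertices
  already placed. Passing to a subset \<open>G\<close> lets a caller keep only maps with many common
  neighbours.\<close>

lemma part_homs_extend:
  assumes fin: "finite VF" "finite X"
    and G: "G \<subseteq> part_homs VF c E k X"
    and N: "\<And>\<psi>. \<psi> \<in> G \<Longrightarrow> N \<psi> = {x \<in> X. \<forall>v\<in>VF. c v < k \<longrightarrow> {x, \<psi> v} \<in> E}"
  shows "(\<Sum>\<psi>\<in>G. card (N \<psi>) ^ card {v \<in> VF. c v = k}) \<le> card (part_homs VF c E (Suc k) X)"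
proof -
  define T where "T = {v \<in> VF. c v = k}"
  define S where "S = Sigma G (\<lambda>\<psi>. T \<rightarrow>\<^sub>E N \<psi>)"
  define g where "g = (\<lambda>(\<psi>, \<chi>) v. if v \<in> T then \<chi> v else (\<psi> v :: nat))"
  have finG: "finite G" using G finite_part_homs[OF fin] finite_subset by blast
  have finN: "finite (N \<psi>)" if "\<psi> \<in> G" for \<psi> using N[OF that] fin by auto
  have "card S = (\<Sum>\<psi>\<in>G. card (N \<psi>) ^ card T)"
    unfolding S_def using fin finN finG by (subst card_SigmaI) (auto simp: T_def card_PiE intro!: finite_PiE)
  moreover have "card S \<le> card (part_homs VF c E (Suc k) X)"
  proof (rule card_inj_on_le[where f = g])
    show "inj_on g S"
    proof (rule inj_onI, clarify)
      fix \<psi> \<chi> \<psi>' \<chi>'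
      assume a: "(\<psi>, \<chi>) \<in> S" "(\<psi>', \<chi>') \<in> S" and eq: "g (\<psi>, \<chi>) = g (\<psi>', \<chi>')"
      have \<psi>: "\<psi> \<in> {v \<in> VF. c v < k} \<rightarrow>\<^sub>E X" "\<psi>' \<in> {v \<in> VF. c v < k} \<rightarrow>\<^sub>E X"
        using a G by (auto simp: S_def part_homs_def)
      have \<chi>: "\<chi> \<in> T \<rightarrow>\<^sub>E N \<psi>" "\<chi>' \<in> T \<rightarrow>\<^sub>E N \<psi>'" using a by (auto simp: S_def)
      have e: "g (\<psi>, \<chi>) v = g (\<psi>', \<chi>') v" for v using eq by simp
      have "\<chi> v = \<chi>' v" for v
        using e[of v] \<chi> by (cases "v \<in> T") (auto simp: g_def PiE_def extensional_def)
      moreover have "\<psi> v = \<psi>' v" for v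
      proof (cases "v \<in> T")
        case True
        then show ?thesis using \<psi> by (auto simp: T_def PiE_def extensional_def)
      qed (use e[of v] in \<open>simp add: g_def\<close>)
      ultimately show "\<psi> = \<psi>' \<and> \<chi> = \<chi>'" by auto
    qed
    show "g ` S \<subseteq> part_homs VF c E (Suc k) X"
    proof clarify
      fix \<psi> \<chi> assume a: "(\<psi>, \<chi>) \<in> S"
      have \<psi>G: "\<psi> \<in> G" and \<chi>: "\<chi> \<in> T \<rightarrow>\<^sub>E N \<psi>" using a by (auto simp: S_def)
      have \<psi>: "\<psi> \<in> part_homs VF c E k X" using \<psi>G G by auto
      have \<chi>N: "\<chi> v \<in> X" "w \<in> VF \<Longrightarrow> c w < k \<Longrightarrow> {\<chi> v, \<psi> w} \<in> E" if "v \<in> T" for v w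
        using \<chi> that N[OF \<psi>G] by (auto simp: PiE_iff)
      have lt: "c v < k" if "v \<notin> T" "v \<in> VF" "c v < Suc k" for v using that by (auto simp: T_def)
      have 1: "g (\<psi>, \<chi>) \<in> {v \<in> VF. c v < Suc k} \<rightarrow>\<^sub>E X"
        using \<psi> \<chi>N(1) lt unfolding part_homs_def g_def
        by (auto simp: PiE_iff extensional_def T_def)
      have 2: "{g (\<psi>, \<chi>) v, g (\<psi>, \<chi>) w} \<in> E"
        if h: "v \<in> VF" "w \<in> VF" "c v < Suc k" "c w < Suc k" "c v \<noteq> c w" for v w
      proof -
        consider "v \<in> T" "w \<notin> T" | "v \<notin> T" "w \<in> T" | "v \<notin> T" "w \<notin> T"
          using h by (auto simp: T_def)
        then show ?thesis
        proof cases
          case 1 then show ?thesis using \<chi>N(2)[of v w] lt[of w] h by (simp add: g_def)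
        next
          case 2 then show ?thesis using \<chi>N(2)[of w v] lt[of v] h by (simp add: g_def insert_commute)
        next
          case 3 then show ?thesis using \<psi> lt[of v] lt[of w] h by (simp add: g_def part_homs_def)
        qed
      qed
      show "g (\<psi>, \<chi>) \<in> part_homs VF c E (Suc k) X"
        using 1 2 by (simp add: part_homs_def)
    qed
    show "finite (part_homs VF c E (Suc k) X)" by (rule finite_part_homs[OF fin])
  qed
  ultimately show ?thesis by (simp add: T_def)
qed

text \<open>Averaging. More than \<gamma> n rich vertices would give more than \<gamma> \<delta>
  n^(m+1) pairs of a map and a common neighbour of its image. Maps with fewer than \<theta> n common
  neighbours account for at most half of these, so at least \<theta> n^m maps have \<theta> n common
  neighbours or more, and each of them has at least (\<theta> n)^t extensions.\<close>

lemma few_rich_vertices: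
  fixes \<delta> \<gamma> :: real
  assumes fin: "finite VF" and X: "X \<subseteq> {..<n}" and pos: "\<delta> > 0" "\<gamma> > 0" "n > 0"
    and few: "real (card (part_homs VF c E (Suc k) X)) <
      (\<gamma> * \<delta> / 2) ^ Suc (card {v \<in> VF. c v = k}) * real n ^ card {v \<in> VF. c v < Suc k}"
  shows "real (card {x \<in> X. real (card (part_homs VF c E k {y \<in> X. {x, y} \<in> E}))
            > \<delta> * real n ^ card {v \<in> VF. c v < k}}) \<le> \<gamma> * real n"
proof (rule ccontr)
  define m t where "m = card {v \<in> VF. c v < k}" and "t = card {v \<in> VF. c v = k}"
  \<comment> \<open>Half of the density of pairs: maps below this threshold contribute at most
    \<theta> n^(m+1), which leaves the other half to \<open>G\<close>.\<close>
  define \<theta> where "\<theta> = \<gamma> * \<delta> / 2"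
  define D where "D = {x \<in> X. real (card (part_homs VF c E k {y \<in> X. {x, y} \<in> E})) > \<delta> * real n ^ m}"
  define R where "R = (\<lambda>\<psi> x. \<forall>v\<in>VF. c v < k \<longrightarrow> {x, \<psi> v} \<in> E)"
  define P where "P = part_homs VF c E k X"
  define N where "N = (\<lambda>\<psi>. {x \<in> X. R \<psi> x})"
  define G where "G = {\<psi> \<in> P. real (card (N \<psi>)) \<ge> \<theta> * real n}"
  assume "\<not> ?thesis"
  then have D: "real (card D) > \<gamma> * real n" by (simp add: D_def m_def)
  have mt: "card {v \<in> VF. c v < Suc k} = m + t"
  proof -
    have "{v \<in> VF. c v < Suc k} = {v \<in> VF. c v < k} \<union> {v \<in> VF. c v = k}" by auto
    then show ?thesis unfolding m_def t_def using fin by (simp only:) (intro card_Un_disjoint, auto)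
  qed
  have finX: "finite X" using X finite_subset by blast
  have finP: "finite P" using finite_part_homs[OF fin finX] by (simp add: P_def)
  have \<theta>: "\<theta> > 0" using pos by (simp add: \<theta>_def)
  have "{\<psi> \<in> P. R \<psi> x} = part_homs VF c E k {y \<in> X. {x, y} \<in> E}" for x
    unfolding P_def R_def part_homs_def by (auto simp: PiE_iff)
  then have dc: "(\<Sum>\<psi>\<in>P. card (N \<psi>)) = (\<Sum>x\<in>X. card (part_homs VF c E k {y \<in> X. {x, y} \<in> E}))"
    unfolding N_def by (intro sum_multicount_gen finP finX) auto
  have "\<gamma> * real n * (\<delta> * real n ^ m) \<le> real (card D) * (\<delta> * real n ^ m)"
    using D pos by (intro mult_right_mono) auto
  also have "\<dots> \<le> (\<Sum>x\<in>D. real (card (part_homs VF c E k {y \<in> X. {x, y} \<in> E})))"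
    using sum_bounded_below[of D "\<delta> * real n ^ m" "\<lambda>x. real (card (part_homs VF c E k {y \<in> X. {x, y} \<in> E}))"]
    by (auto simp: D_def)
  also have "\<dots> \<le> (\<Sum>x\<in>X. real (card (part_homs VF c E k {y \<in> X. {x, y} \<in> E})))"
    by (intro sum_mono2 finX) (auto simp: D_def)
  also have "\<dots> = (\<Sum>\<psi>\<in>P. real (card (N \<psi>)))" using dc by (simp flip: of_nat_sum)
  also have "\<dots> \<le> (\<Sum>\<psi>\<in>P. (if \<psi> \<in> G then real n else 0) + \<theta> * real n)"
  proof (rule sum_mono)
    fix \<psi> assume "\<psi> \<in> P"
    have "card (N \<psi>) \<le> card {..<n}" using X by (intro card_mono) (auto simp: N_def)
    then show "real (card (N \<psi>)) \<le> (if \<psi> \<in> G then real n else 0) + \<theta> * real n"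
      using \<open>\<psi> \<in> P\<close> \<theta> by (auto simp: G_def intro: add_increasing2)
  qed
  also have "\<dots> = real (card G) * real n + real (card P) * (\<theta> * real n)"
  proof -
    have "P \<inter> G = G" by (auto simp: G_def)
    then show ?thesis using finP by (simp add: sum.distrib sum.If_cases)
  qed
  also have "\<dots> \<le> real (card G) * real n + real n ^ m * (\<theta> * real n)"
  proof -
    have "real (card P) \<le> real n ^ m"
      using card_part_homs_le[OF fin X, of c E k] by (simp add: P_def m_def flip: of_nat_power)
    then show ?thesis using \<theta> by (intro add_left_mono mult_right_mono) auto
  qed
  finally have "\<theta> * real n ^ m * real n \<le> real (card G) * real n"
    by (simp add: \<theta>_def algebra_simps)
  then have Glow: "\<theta> * real n ^ m \<le> real (card G)" using pos by simp
  have "\<theta> ^ Suc t * real n ^ (m + t) = \<theta> * real n ^ m * (\<theta> * real n) ^ t"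
    by (simp add: power_add power_mult_distrib)
  also have "\<dots> \<le> real (card G) * (\<theta> * real n) ^ t"
    using Glow \<theta> by (intro mult_right_mono) auto
  also have "\<dots> \<le> (\<Sum>\<psi>\<in>G. real (card (N \<psi>)) ^ t)"
    by (rule sum_bounded_below) (use \<theta> in \<open>auto simp: G_def intro!: power_mono\<close>)
  also have "\<dots> = real (\<Sum>\<psi>\<in>G. card (N \<psi>) ^ t)" by simp
  also have "\<dots> \<le> real (card (part_homs VF c E (Suc k) X))"
    unfolding t_def of_nat_le_iff
    by (intro part_homs_extend fin finX) (auto simp: G_def P_def N_def R_def)
  finally show False using few mt by (simp add: \<theta>_def t_def)
qed

subsection \<open>Stability\<close>

lemma finite_arcs: "finite X \<Longrightarrow> finite Y \<Longrightarrow> finite (arcs E X Y)"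
  unfolding arcs_def by (rule finite_subset[of _ "X \<times> Y"]) auto

lemma card_arcs_sum: "finite X \<Longrightarrow> finite Y \<Longrightarrow> card (arcs E X Y) = (\<Sum>x\<in>X. card {y \<in> Y. {x, y} \<in> E})"
proof -
  assume "finite X" "finite Y"
  have "arcs E X Y = Sigma X (\<lambda>x. {y \<in> Y. {x, y} \<in> E})" by (auto simp: arcs_def)
  then show ?thesis using \<open>finite X\<close> \<open>finite Y\<close> by (simp add: card_SigmaI)
qed

lemma card_arcs_swap: "card (arcs E X Y) = card (arcs E Y X)"
proof -
  have "arcs E Y X = prod.swap ` arcs E X Y" by (auto simp: arcs_def insert_commute image_iff)
  then show ?thesis by (simp add: card_image)
qed

definition mono_arcs :: "nat set set \<Rightarrow> (nat \<Rightarrow> nat) \<Rightarrow> nat set \<Rightarrow> (nat \<times> nat) set" where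
  "mono_arcs E p X = {(x, y) \<in> X \<times> X. {x, y} \<in> E \<and> p x = p y}"

definition cross_pairs :: "(nat \<Rightarrow> nat) \<Rightarrow> nat set \<Rightarrow> (nat \<times> nat) set" where
  "cross_pairs p X = {(x, y) \<in> X \<times> X. p x \<noteq> p y}"

text \<open>With \<open>A\<close> a neighbourhood of maximum size in \<open>X'\<close>, the rest
  \<open>V0\<close> of \<open>X'\<close> becomes the new class \<open>k\<close>. Arcs inside
  \<open>V0\<close> enter both \<open>arcs\<close> and \<open>mono_arcs\<close>, arcs between
  \<open>V0\<close> and \<open>A\<close> enter \<open>arcs\<close> in both directions, so the left
  side grows by twice the degree sum over \<open>V0\<close>. That is at most 2 |V0| |A|, the number
  of new cross pairs. Pairs touching \<open>D\<close> cost 2 |D| n in each of the two counts.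
  Exceptional values of \<open>p0\<close> move up by one, which frees \<open>k\<close> and keeps
  them exceptional.\<close>

lemma degree_majorization_step:
  fixes A X' D :: "nat set"
  assumes X: "X = X' \<union> D" "X' \<inter> D = {}" "A \<subseteq> X'" "X \<subseteq> {..<n}"
    and deg: "\<And>y. y \<in> X' - A \<Longrightarrow> card {z \<in> X'. {y, z} \<in> E} \<le> card A"
    and p: "\<And>x. p x = (if x \<in> A then (if p0 x < k then p0 x else Suc (p0 x))
               else if x \<in> X' then k else Suc k)"
  shows "card (arcs E X X) + card (mono_arcs E p X) + card (cross_pairs p0 A)
    \<le> card (arcs E A A) + card (mono_arcs E p0 A) + card (cross_pairs p X) + 4 * (card D * n)"
proof -
  define V0 where "V0 = X' - A"
  have finX: "finite X" using X(4) finite_subset by blast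
  have fin: "finite X'" "finite A" "finite D" "finite V0"
    using finX X finite_subset[of A X'] by (auto simp: V0_def)
  have finm: "finite (mono_arcs E q Y)" "finite (cross_pairs q Y)" if "finite Y" for q Y
    unfolding mono_arcs_def cross_pairs_def using that
    by (auto intro!: finite_subset[OF _ finite_cartesian_product[OF that that]])
  have pA: "p x \<noteq> k" if "x \<in> A" for x using that by (simp add: p)
  have pV: "p x = k" if "x \<in> V0" for x using that by (simp add: p V0_def)
  have pAA: "p x = p y \<longleftrightarrow> p0 x = p0 y" if "x \<in> A" "y \<in> A" for x y using that by (auto simp: p)
  have cX: "card X \<le> n" using card_mono[OF _ X(4)] by simp
  let ?DX = "D \<times> X \<union> X \<times> D"
  have "card ?DX \<le> card D * card X + card X * card D"
    by (rule order_trans[OF card_Un_le]) (simp add: card_cartesian_product)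
  also have "\<dots> \<le> 2 * (card D * n)" using mult_le_mono2[OF cX, of "card D"] mult.commute[of "card X" "card D"] by linarith
  finally have DX: "card ?DX \<le> 2 * (card D * n)" .
  have "arcs E X X \<subseteq> ((arcs E A A \<union> arcs E V0 V0) \<union> (arcs E V0 A \<union> arcs E A V0)) \<union> ?DX"
    using X by (auto simp: arcs_def V0_def)
  then have "card (arcs E X X) \<le> card (((arcs E A A \<union> arcs E V0 V0) \<union> (arcs E V0 A \<union> arcs E A V0)) \<union> ?DX)"
    using fin finX by (intro card_mono) (auto intro: finite_arcs)
  also have "\<dots> \<le> card (arcs E A A) + card (arcs E V0 V0) + (card (arcs E V0 A) + card (arcs E A V0)) + card ?DX"
    by (intro card_Un_le[THEN order_trans] add_mono card_Un_le order_refl)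
  finally have 1: "card (arcs E X X) \<le> card (arcs E A A) + card (arcs E V0 V0) + 2 * card (arcs E V0 A) + 2 * (card D * n)"
    using DX card_arcs_swap[of E A V0] by linarith
  have "mono_arcs E p X \<subseteq> (mono_arcs E p0 A \<union> arcs E V0 V0) \<union> ?DX"
  proof (rule subrelI)
    fix x y assume a: "(x, y) \<in> mono_arcs E p X"
    show "(x, y) \<in> (mono_arcs E p0 A \<union> arcs E V0 V0) \<union> ?DX"
    proof (cases "x \<in> D \<or> y \<in> D \<or> x \<in> V0 \<and> y \<in> V0")
      case True
      then show ?thesis using a by (auto simp: mono_arcs_def arcs_def)
    next
      case False
      then have e: "{x, y} \<in> E" "p x = p y" "x \<in> A \<or> x \<in> V0" "y \<in> A \<or> y \<in> V0" "\<not> (x \<in> V0 \<and> y \<in> V0)"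
        using a X(1) by (auto simp: mono_arcs_def V0_def)
      then have "x \<in> A" "y \<in> A" using pA pV by metis+
      then show ?thesis using e pAA by (auto simp: mono_arcs_def)
    qed
  qed
  then have "card (mono_arcs E p X) \<le> card ((mono_arcs E p0 A \<union> arcs E V0 V0) \<union> ?DX)"
    using fin finX by (intro card_mono) (auto intro: finite_arcs finm)
  also have "\<dots> \<le> card (mono_arcs E p0 A) + card (arcs E V0 V0) + card ?DX"
    by (intro card_Un_le[THEN order_trans] add_mono card_Un_le order_refl)
  finally have 2: "card (mono_arcs E p X) \<le> card (mono_arcs E p0 A) + card (arcs E V0 V0) + 2 * (card D * n)"
    using DX by linarith
  have "card (arcs E V0 V0) + card (arcs E V0 A) = card (arcs E V0 X')"
  proof -
    have "arcs E V0 X' = arcs E V0 V0 \<union> arcs E V0 A" "arcs E V0 V0 \<inter> arcs E V0 A = {}"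
      using X by (auto simp: arcs_def V0_def)
    then show ?thesis using fin by (simp add: card_Un_disjoint finite_arcs)
  qed
  also have "\<dots> \<le> card V0 * card A"
    using fin sum_bounded_above[of V0 "\<lambda>y. card {z \<in> X'. {y, z} \<in> E}" "card A"] deg
    by (simp add: card_arcs_sum V0_def)
  finally have 3: "card (arcs E V0 V0) + card (arcs E V0 A) \<le> card V0 * card A" .
  have "card (cross_pairs p0 A \<union> (V0 \<times> A \<union> A \<times> V0)) \<le> card (cross_pairs p X)"
  proof (intro card_mono finm finX subsetI)
    fix z assume "z \<in> cross_pairs p0 A \<union> (V0 \<times> A \<union> A \<times> V0)"
    then obtain x y where z: "z = (x, y)" "x \<in> A \<and> y \<in> A \<and> p0 x \<noteq> p0 y \<or> x \<in> V0 \<and> y \<in> A \<or> x \<in> A \<and> y \<in> V0"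
      by (auto simp: cross_pairs_def)
    then have "p x \<noteq> p y" using pA pV pAA by metis
    moreover have "x \<in> X" "y \<in> X" using z X by (auto simp: V0_def)
    ultimately show "z \<in> cross_pairs p X" using z by (simp add: cross_pairs_def)
  qed
  moreover have "card (cross_pairs p0 A \<union> (V0 \<times> A \<union> A \<times> V0)) = card (cross_pairs p0 A) + (card V0 * card A + card A * card V0)"
  proof -
    have "card (V0 \<times> A \<union> A \<times> V0) = card V0 * card A + card A * card V0"
      using fin by (subst card_Un_disjoint) (auto simp: V0_def card_cartesian_product)
    moreover have "cross_pairs p0 A \<inter> (V0 \<times> A \<union> A \<times> V0) = {}"
      by (auto simp: cross_pairs_def V0_def)
    ultimately show ?thesis using fin by (subst card_Un_disjoint) (auto simp: finm)
  qed
  ultimately have 4: "card (cross_pairs p0 A) + 2 * (card V0 * card A) \<le> card (cross_pairs p X)"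
    by (simp add: mult.commute)
  show ?thesis using 1 2 3 4 by linarith
qed

text \<open>Vertices with \<open>p x \<ge> k\<close> are exceptional: they were discarded as rich during the induction.
  When all vertices are used, the inequality says that twice the number of edges plus twice the
  number of bad edges is at most twice the number of cross pairs, up to an error.\<close>

lemma stability:
  assumes fin: "finite VF"
  shows "\<gamma> > 0 \<Longrightarrow> \<exists>\<delta>>0. \<forall>n X E. n > 0 \<and> X \<subseteq> {..<n} \<and>
     real (card (part_homs VF c E (Suc k) X)) < \<delta> * real n ^ card {v \<in> VF. c v < Suc k} \<longrightarrow>
     (\<exists>p. real (card {x \<in> X. p x \<ge> k}) \<le> \<gamma> * real n \<and>
        real (card (arcs E X X) + card (mono_arcs E p X)) \<le> real (card (cross_pairs p X)) + \<gamma> * real n ^ 2)"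
proof (induction k arbitrary: \<gamma>)
  case 0
  \<comment> \<open>With a single class there are no conditions on the maps, so few maps means that
    \<open>X\<close> itself has fewer than \<open>\<gamma>' * n\<close> vertices. All of them count
    as exceptional, and both arc counts disappear in the error term; the factor 1/2 pays for having
    two counts.\<close>
  define \<gamma>' where "\<gamma>' = \<gamma> / 2"
  define t where "t = card {v \<in> VF. c v < Suc 0}"
  have \<gamma>': "\<gamma>' > 0" using 0 by (simp add: \<gamma>'_def)
  show ?case
  proof (intro exI[of _ "\<gamma>' ^ t"] conjI allI impI, goal_cases)
    case 1 then show ?case using \<gamma>' by simp
  next
    case (2 n X E)
    have X: "X \<subseteq> {..<n}" "n > 0" using 2 by auto
    have finX: "finite X" using X finite_subset by blast
    have "part_homs VF c E (Suc 0) X = ({v \<in> VF. c v < Suc 0} \<rightarrow>\<^sub>E X)"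
      by (auto simp: part_homs_def)
    then have "card (part_homs VF c E (Suc 0) X) = card X ^ t"
      using fin by (simp add: card_PiE t_def)
    then have "real (card X) ^ t < (\<gamma>' * real n) ^ t"
      using 2 by (simp add: t_def power_mult_distrib)
    then have cX: "real (card X) < \<gamma>' * real n"
      using \<gamma>' by (meson mult_nonneg_nonneg of_nat_0_le_iff order_less_imp_le power_less_imp_less_base)
    have cXn: "card X \<le> n" using card_mono[OF _ X(1)] by simp
    have "card (arcs E X X) \<le> card (X \<times> X)" "card (mono_arcs E (\<lambda>_. 0) X) \<le> card (X \<times> X)"
      using finX by (intro card_mono; auto simp: arcs_def mono_arcs_def)+
    then have "real (card (arcs E X X) + card (mono_arcs E (\<lambda>_. 0) X)) \<le> 2 * (real (card X) * real (card X))"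
      by (simp add: card_cartesian_product flip: of_nat_mult)
    also have "\<dots> \<le> 2 * (\<gamma>' * real n * real n)"
      using cX cXn \<gamma>' by (intro mult_left_mono mult_mono) auto
    also have "\<dots> = \<gamma> * real n ^ 2" by (simp add: \<gamma>'_def power2_eq_square)
    finally have "real (card (arcs E X X) + card (mono_arcs E (\<lambda>_. 0) X)) \<le> \<gamma> * real n ^ 2" .
    moreover have "real (card X) \<le> \<gamma> * real n" using cX 0 unfolding \<gamma>'_def
      using mult_nonneg_nonneg[of \<gamma> "real n"] by linarith
    ultimately show ?case by (intro exI[of _ "\<lambda>_. 0"]) auto
  qed
next
  case (Suc k)
  \<comment> \<open>\<open>\<gamma>1\<close> is the error inherited from \<open>A\<close>; the error
    4 |D| n of the majorization step is at most \<open>4 * \<gamma>2 * n^2\<close>, the other half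
    of \<gamma>.\<close>
  define \<gamma>1 \<gamma>2 where "\<gamma>1 = \<gamma> / 2" and "\<gamma>2 = \<gamma> / 8"
  have pos: "\<gamma>1 > 0" "\<gamma>2 > 0" using Suc.prems by (auto simp: \<gamma>1_def \<gamma>2_def)
  obtain \<delta> where \<delta>: "\<delta> > 0" and IH: "\<forall>n X E. n > 0 \<and> X \<subseteq> {..<n} \<and>
     real (card (part_homs VF c E (Suc k) X)) < \<delta> * real n ^ card {v \<in> VF. c v < Suc k} \<longrightarrow>
     (\<exists>p. real (card {x \<in> X. p x \<ge> k}) \<le> \<gamma>1 * real n \<and>
        real (card (arcs E X X) + card (mono_arcs E p X)) \<le> real (card (cross_pairs p X)) + \<gamma>1 * real n ^ 2)"
    using Suc.IH[OF pos(1)] by (elim exE conjE)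
  define t where "t = card {v \<in> VF. c v = Suc k}"
  define m where "m = card {v \<in> VF. c v < Suc k}"
  show ?case
  proof (intro exI[of _ "(\<gamma>2 * (\<delta> / 2) / 2) ^ Suc t"] conjI allI impI, goal_cases)
    case 1 then show ?case using pos \<delta> by simp
  next
    case (2 n X E)
    have X: "X \<subseteq> {..<n}" "n > 0" using 2 by auto
    have finX: "finite X" using X finite_subset by blast
    \<comment> \<open>The threshold uses \<delta>/2 because the induction hypothesis needs strictly
      fewer than \<open>\<delta> * n^m\<close> maps.\<close>
    define D where "D = {x \<in> X. real (card (part_homs VF c E (Suc k) {y \<in> X. {x, y} \<in> E})) > \<delta> / 2 * real n ^ m}"
    define X' where "X' = X - D"
    have D: "real (card D) \<le> \<gamma>2 * real n"
      unfolding D_def m_def using 2 \<delta> pos by (intro few_rich_vertices fin) (auto simp: t_def)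
    have "\<exists>A p0. A \<subseteq> X' \<and> (\<forall>y\<in>X'. card {z \<in> X'. {y, z} \<in> E} \<le> card A) \<and>
       real (card {x \<in> A. p0 x \<ge> k}) \<le> \<gamma>1 * real n \<and>
        real (card (arcs E A A) + card (mono_arcs E p0 A)) \<le> real (card (cross_pairs p0 A)) + \<gamma>1 * real n ^ 2"
    proof (cases "X' = {}")
      case True
      then show ?thesis using pos by (intro exI[of _ "{}"]) (auto simp: arcs_def mono_arcs_def cross_pairs_def)
    next
      case False
      define d where "d = (\<lambda>y. card {z \<in> X'. {y, z} \<in> E})"
      have "\<exists>x\<in>X'. \<forall>y\<in>X'. d y \<le> d x"
      proof -
        have fd: "finite (d ` X')" "d ` X' \<noteq> {}" using False finX by (auto simp: X'_def)
        obtain x where "x \<in> X'" "d x = Max (d ` X')" using Max_in[OF fd] by auto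
        then show ?thesis using fd by (intro bexI[of _ x]) auto
      qed
      then obtain x where x: "x \<in> X'" "\<forall>y\<in>X'. d y \<le> d x" by blast
      \<comment> \<open>As \<open>x\<close> is not rich, few maps of the first \<open>k + 1\<close>
        classes go into its neighbourhood, so the induction hypothesis applies to \<open>A\<close>;
        maximality of the degree of \<open>x\<close> gives the bound needed for the majorization
        step.\<close>
      define A where "A = {z \<in> X'. {x, z} \<in> E}"
      have "card (part_homs VF c E (Suc k) A) \<le> card (part_homs VF c E (Suc k) {y \<in> X. {x, y} \<in> E})"
        using finX by (intro card_mono finite_part_homs part_homs_mono fin) (auto simp: A_def X'_def)
      moreover have "real (card (part_homs VF c E (Suc k) {y \<in> X. {x, y} \<in> E})) \<le> \<delta> / 2 * real n ^ m"
        using x(1) by (auto simp: X'_def D_def)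
      moreover have "\<delta> / 2 * real n ^ m < \<delta> * real n ^ m" using \<delta> X by simp
      moreover have A_sub: "A \<subseteq> {..<n}" using X by (auto simp: A_def X'_def)
      ultimately have "real (card (part_homs VF c E (Suc k) A)) < \<delta> * real n ^ m" by linarith
      then obtain p0 where "real (card {x \<in> A. p0 x \<ge> k}) \<le> \<gamma>1 * real n \<and>
        real (card (arcs E A A) + card (mono_arcs E p0 A)) \<le> real (card (cross_pairs p0 A)) + \<gamma>1 * real n ^ 2"
        using IH[rule_format, of n A E] X A_sub unfolding m_def by blast
      moreover have "A \<subseteq> X'" "\<forall>y\<in>X'. card {z \<in> X'. {y, z} \<in> E} \<le> card A"
        using x by (auto simp: A_def d_def)
      ultimately show ?thesis by blast
    qed
    then obtain A p0 where A: "A \<subseteq> X'" "\<And>y. y \<in> X' \<Longrightarrow> card {z \<in> X'. {y, z} \<in> E} \<le> card A"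
      and p0: "real (card {x \<in> A. p0 x \<ge> k}) \<le> \<gamma>1 * real n"
        "real (card (arcs E A A) + card (mono_arcs E p0 A)) \<le> real (card (cross_pairs p0 A)) + \<gamma>1 * real n ^ 2"
      by auto
    define p where "p = (\<lambda>x. if x \<in> A then (if p0 x < k then p0 x else Suc (p0 x))
               else if x \<in> X' then k else Suc k)"
    have "card (arcs E X X) + card (mono_arcs E p X) + card (cross_pairs p0 A)
    \<le> card (arcs E A A) + card (mono_arcs E p0 A) + card (cross_pairs p X) + 4 * (card D * n)"
      using A X by (intro degree_majorization_step) (auto simp: p_def X'_def D_def)
    then have "real (card (arcs E X X) + card (mono_arcs E p X) + card (cross_pairs p0 A))
    \<le> real (card (arcs E A A) + card (mono_arcs E p0 A) + card (cross_pairs p X) + 4 * (card D * n))"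
      by (simp only: of_nat_le_iff)
    moreover have "real (4 * (card D * n)) \<le> 4 * (\<gamma>2 * real n * real n)"
      using D by (simp add: mult_right_mono)
    ultimately have "real (card (arcs E X X) + card (mono_arcs E p X)) \<le> real (card (cross_pairs p X)) + \<gamma>1 * real n ^ 2 + 4 * (\<gamma>2 * real n * real n)"
      using p0(2) by simp
    also have "\<dots> = real (card (cross_pairs p X)) + \<gamma> * real n ^ 2"
      by (simp add: \<gamma>1_def \<gamma>2_def power2_eq_square)
    finally have main: "real (card (arcs E X X) + card (mono_arcs E p X)) \<le> real (card (cross_pairs p X)) + \<gamma> * real n ^ 2" .
    have finA: "finite A" using A finX by (auto simp: X'_def intro: finite_subset)
    have "card {x \<in> X. p x \<ge> Suc k} \<le> card ({x \<in> A. p0 x \<ge> k} \<union> D)"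
      using finX finA by (intro card_mono) (auto simp: p_def X'_def D_def split: if_splits)
    also have "\<dots> \<le> card {x \<in> A. p0 x \<ge> k} + card D" by (rule card_Un_le)
    finally have "real (card {x \<in> X. p x \<ge> Suc k}) \<le> real (card {x \<in> A. p0 x \<ge> k}) + real (card D)"
      by linarith
    also have "\<dots> \<le> \<gamma>1 * real n + \<gamma>2 * real n" using p0 D by linarith
    also have "\<dots> \<le> \<gamma> * real n" using Suc.prems by (simp add: \<gamma>1_def \<gamma>2_def)
    finally show ?case using main by blast
  qed
qed

subsection \<open>Turan graphs\<close>

lemma all_edges_iff: "{x, y} \<in> all_edges n \<longleftrightarrow> x < n \<and> y < n \<and> x \<noteq> y"
  by (auto simp: all_edges_def card_insert_if)

lemma turan_edges_iff: "{x, y} \<in> turan_edges n p \<longleftrightarrow> x < n \<and> y < n \<and> p x \<noteq> p y"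
  by (auto simp: turan_edges_def all_edges_iff)

lemma turan_edges_subset: "turan_edges n p \<subseteq> all_edges n"
  by (auto simp: turan_edges_def)

lemma finite_all_edges: "finite (all_edges n)"
  unfolding all_edges_def by (rule finite_subset[of _ "Pow {0..<n}"]) auto

lemma all_edges_pairE:
  assumes "e \<in> all_edges n" obtains x y where "e = {x, y}" "x < n" "y < n" "x \<noteq> y"
  using assms by (auto simp: all_edges_def card_2_iff)

lemma card_arcs:
  assumes "E \<subseteq> all_edges n"
  shows "card (arcs E {..<n} {..<n}) = 2 * card E"
proof -
  have "finite E" using assms finite_all_edges finite_subset by blast
  then show ?thesis using assms
  proof (induction E rule: finite_induct)
    case empty then show ?case by (simp add: arcs_def)
  next
    case (insert e E)
    obtain x y where e: "e = {x, y}" "x < n" "y < n" "x \<noteq> y"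
      using insert.prems by (auto elim: all_edges_pairE)
    have "arcs (insert e E) {..<n} {..<n} = arcs E {..<n} {..<n} \<union> {(x, y), (y, x)}"
      using e by (auto simp: arcs_def doubleton_eq_iff)
    moreover have "arcs E {..<n} {..<n} \<inter> {(x, y), (y, x)} = {}"
      using e insert.hyps by (auto simp: arcs_def insert_commute)
    ultimately show ?case using insert e
      by (simp add: card_Un_disjoint finite_arcs card_insert_if)
  qed
qed

lemma card_mono_arcs:
  assumes "E \<subseteq> all_edges n"
  shows "card (mono_arcs E p {..<n}) = 2 * card (E - turan_edges n p)"
proof -
  have "mono_arcs E p {..<n} = arcs (E - turan_edges n p) {..<n} {..<n}"
    by (auto simp: mono_arcs_def arcs_def turan_edges_iff)
  then show ?thesis using card_arcs[of "E - turan_edges n p" n] assms by auto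
qed

lemma card_cross_pairs: "card (cross_pairs p {..<n}) = 2 * card (turan_edges n p)"
proof -
  have "cross_pairs p {..<n} = arcs (turan_edges n p) {..<n} {..<n}"
    by (auto simp: cross_pairs_def arcs_def turan_edges_iff)
  then show ?thesis using card_arcs[OF turan_edges_subset] by auto
qed

definition part_size :: "nat \<Rightarrow> (nat \<Rightarrow> nat) \<Rightarrow> nat \<Rightarrow> nat" where
  "part_size n p i = card {v. v < n \<and> p v = i}"

lemma sum_part_size:
  assumes "\<forall>v<n. p v < r"
  shows "(\<Sum>i<r. part_size n p i) = n"
proof -
  have "{..<n} = (\<Union>i<r. {v. v < n \<and> p v = i})" using assms by auto
  then have "card {..<n} = (\<Sum>i<r. card {v. v < n \<and> p v = i})"
    by (simp only:) (intro card_UN_disjoint, auto)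
  then show ?thesis by (simp add: part_size_def)
qed

lemma card_turan_edges:
  assumes "\<forall>v<n. p v < r"
  shows "2 * card (turan_edges n p) + (\<Sum>i<r. part_size n p i ^ 2) = n ^ 2"
proof -
  let ?M = "\<Union>i<r. {v. v < n \<and> p v = i} \<times> {v. v < n \<and> p v = i}"
  have "{..<n} \<times> {..<n} = cross_pairs p {..<n} \<union> ?M" "cross_pairs p {..<n} \<inter> ?M = {}"
    using assms by (auto simp: cross_pairs_def)
  moreover have "finite (cross_pairs p {..<n})"
    unfolding cross_pairs_def by (rule finite_subset[of _ "{..<n} \<times> {..<n}"]) auto
  ultimately have "card ({..<n} \<times> {..<n}) = card (cross_pairs p {..<n}) + card ?M"
    by (simp only:) (intro card_Un_disjoint, auto)
  moreover have "card ?M = (\<Sum>i<r. card ({v. v < n \<and> p v = i} \<times> {v. v < n \<and> p v = i}))"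
    by (intro card_UN_disjoint) auto
  ultimately show ?thesis
    by (simp add: card_cross_pairs card_cartesian_product part_size_def power2_eq_square)
qed

text \<open>Residue classes serve as the model of a balanced partition; that the value is maximal
  and the same for every balanced partition is shown below.\<close>

definition turan_number :: "nat \<Rightarrow> nat \<Rightarrow> nat" where
  "turan_number r n = card (turan_edges n (\<lambda>v. v mod r))"

text \<open>Since the part sizes sum to n, the linear terms of the products can be absorbed into the
  right side, which depends on n and r only. For integers each product is nonnegative and vanishes
  exactly for sizes a and a + 1, so one identity yields both the maximum and the partitions
  attaining it.\<close>

lemma card_turan_edges_excess:
  assumes "\<forall>v<n. p v < r" and "a = n div r"
  shows "2 * int (card (turan_edges n p)) +
     (\<Sum>i<r. (int (part_size n p i) - int a) * (int (part_size n p i) - int a - 1))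
     = int n ^ 2 - (2 * int a + 1) * int n + int r * int a * (int a + 1)"
proof -
  have "(\<Sum>i<r. (int (part_size n p i) - int a) * (int (part_size n p i) - int a - 1))
    = (\<Sum>i<r. int (part_size n p i) ^ 2 - (2 * int a + 1) * int (part_size n p i) + int a * (int a + 1))"
    by (intro sum.cong) (auto simp: algebra_simps power2_eq_square)
  also have "\<dots> = (\<Sum>i<r. int (part_size n p i) ^ 2) - (2 * int a + 1) * (\<Sum>i<r. int (part_size n p i)) + int r * (int a * (int a + 1))"
    by (simp add: sum.distrib sum_subtractf sum_distrib_left)
  also have "(\<Sum>i<r. int (part_size n p i)) = int n"
    using sum_part_size[OF assms(1)] by (simp flip: of_nat_sum)
  also have "(\<Sum>i<r. int (part_size n p i) ^ 2) = int n ^ 2 - 2 * int (card (turan_edges n p))"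
  proof -
    have "2 * int (card (turan_edges n p)) + (\<Sum>i<r. int (part_size n p i) ^ 2) = int n ^ 2"
      using card_turan_edges[OF assms(1)]
      by (metis (no_types, lifting) of_nat_add of_nat_mult of_nat_numeral of_nat_power of_nat_sum sum.cong)
    then show ?thesis by simp
  qed
  finally show ?thesis by (simp add: algebra_simps)
qed

lemma part_size_mod:
  assumes "i < r" shows "part_size n (\<lambda>v. v mod r) i \<in> {n div r, Suc (n div r)}"
proof -
  have "{v. v < n \<and> v mod r = i} = (\<lambda>k. k * r + i) ` {k. k * r + i < n}"
  proof (intro set_eqI iffI)
    fix v assume "v \<in> {v. v < n \<and> v mod r = i}"
    then have "v div r * r + i = v" "v < n" using div_mult_mod_eq[of v r] by auto
    then show "v \<in> (\<lambda>k. k * r + i) ` {k. k * r + i < n}" by (intro image_eqI[of _ _ "v div r"]) auto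
  qed (use assms in auto)
  then have eq: "part_size n (\<lambda>v. v mod r) i = card {k. k * r + i < n}"
    unfolding part_size_def using assms by (simp add: card_image inj_on_def)
  have sub: "{k. k * r + i < n} \<subseteq> {..n div r}"
    using assms by (auto simp: less_eq_div_iff_mult_less_eq)
  have "{..<n div r} \<subseteq> {k. k * r + i < n}"
  proof clarify
    fix k assume "k < n div r"
    then have "Suc k * r \<le> n" using assms by (metis Suc_leI less_eq_div_iff_mult_less_eq less_zeroE not_gr0)
    then show "k * r + i < n" using assms by simp
  qed
  then have "card {..<n div r} \<le> card {k. k * r + i < n}" using sub
    by (intro card_mono) (auto intro: finite_subset)
  moreover have "card {k. k * r + i < n} \<le> card {..n div r}" using sub by (intro card_mono) auto
  ultimately show ?thesis using eq by auto
qed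

lemma consecutive_mult_nonneg: "(s - a) * (s - a - 1) \<ge> (0::int)"
proof (cases "s \<le> a")
  case True then show ?thesis by (intro mult_nonpos_nonpos) auto
next
  case False then show ?thesis by (intro mult_nonneg_nonneg) auto
qed

lemma turan_number_eq:
  assumes "r > 0" and "\<forall>v<n. p v < r" and "\<And>i. i < r \<Longrightarrow> part_size n p i \<in> {n div r, Suc (n div r)}"
  shows "card (turan_edges n p) = turan_number r n"
proof -
  have z: "(\<Sum>i<r. (int (part_size n q i) - int (n div r)) * (int (part_size n q i) - int (n div r) - 1)) = 0"
    if "\<And>i. i < r \<Longrightarrow> part_size n q i \<in> {n div r, Suc (n div r)}" for q
    using that by (intro sum.neutral) fastforce
  have "\<forall>v<n. v mod r < r" using assms by auto
  from card_turan_edges_excess[OF this refl] card_turan_edges_excess[OF assms(2) refl]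
  show ?thesis using z[OF assms(3)] z[OF part_size_mod] unfolding turan_number_def by simp
qed

lemma card_turan_edges_le:
  assumes "r > 0" and "\<forall>v<n. p v < r"
  shows "card (turan_edges n p) \<le> turan_number r n"
proof -
  have z': "(\<Sum>i<r. (int (part_size n p i) - int (n div r)) * (int (part_size n p i) - int (n div r) - 1)) \<ge> 0"
    by (intro sum_nonneg consecutive_mult_nonneg)
  have z: "(\<Sum>i<r. (int (part_size n (\<lambda>v. v mod r) i) - int (n div r)) * (int (part_size n (\<lambda>v. v mod r) i) - int (n div r) - 1)) = 0"
    using part_size_mod by (intro sum.neutral) fastforce
  have "\<forall>v<n. v mod r < r" using assms by auto
  from card_turan_edges_excess[OF this refl] card_turan_edges_excess[OF assms(2) refl]
    z'
  show ?thesis unfolding turan_number_def using z by simp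
qed

text \<open>The squared deviations of the part sizes from n/r add up to a constant minus twice the
  number of cross edges. For the residue classes each deviation is at most 1, so losing at most
  \<epsilon> edges allows a sum of at most r + 2 \<epsilon>, and no single part can fall below half
  of the mean.\<close>

lemma part_size_large:
  fixes \<epsilon> :: real
  assumes "r > 0" and p: "\<forall>v<n. p v < r" and "i < r"
    and near: "real (turan_number r n) - real (card (turan_edges n p)) \<le> \<epsilon>"
    and n: "real r + 2 * \<epsilon> \<le> (real n / (2 * real r))\<^sup>2"
  shows "real (part_size n p i) \<ge> real n / (2 * real r)"
proof -
  define b where "b = real n / real r"
  have sq: "(\<Sum>i<r. (real (part_size n q i) - b)\<^sup>2) = real n ^ 2 - 2 * real (card (turan_edges n q)) - real n * b"
    if q: "\<forall>v<n. q v < r" for q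
  proof -
    have "(\<Sum>i<r. (real (part_size n q i) - b)\<^sup>2) =
        (\<Sum>i<r. real (part_size n q i) ^ 2) - 2 * b * (\<Sum>i<r. real (part_size n q i)) + real r * b\<^sup>2"
      by (simp add: power2_diff sum.distrib sum_subtractf sum_distrib_left mult_ac)
    also have "(\<Sum>i<r. real (part_size n q i)) = real n"
      using sum_part_size[OF q] by (simp flip: of_nat_sum)
    also have "(\<Sum>i<r. real (part_size n q i) ^ 2) = real n ^ 2 - 2 * real (card (turan_edges n q))"
    proof -
      have "real (2 * card (turan_edges n q) + (\<Sum>i<r. part_size n q i ^ 2)) = real (n ^ 2)"
        using card_turan_edges[OF q] by simp
      then show ?thesis by simp
    qed
    also have "real r * b\<^sup>2 = real n * b" using assms(1) by (simp add: b_def power2_eq_square)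
    finally show ?thesis by simp
  qed
  have m: "\<forall>v<n. v mod r < r" using assms by auto
  have "(\<Sum>i<r. (real (part_size n (\<lambda>v. v mod r) i) - b)\<^sup>2) \<le> (\<Sum>i<r. 1)"
  proof (rule sum_mono)
    fix i assume "i \<in> {..<r}"
    have "real (n div r) \<le> b" unfolding b_def by (rule of_nat_div_le_of_nat)
    moreover have "b \<le> real (Suc (n div r))"
    proof -
      have "n < Suc (n div r) * r" using assms(1) dividend_less_div_times[of r n] by simp
      then have "real n < real (Suc (n div r)) * real r" by (metis of_nat_less_iff of_nat_mult)
      then show ?thesis unfolding b_def using assms(1) by (simp add: divide_le_eq)
    qed
    ultimately have "\<bar>real (part_size n (\<lambda>v. v mod r) i) - b\<bar> \<le> 1"
      using part_size_mod[of i r n] \<open>i \<in> {..<r}\<close> by auto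
    then show "(real (part_size n (\<lambda>v. v mod r) i) - b)\<^sup>2 \<le> 1" by (simp add: abs_square_le_1)
  qed
  then have "(\<Sum>i<r. (real (part_size n p i) - b)\<^sup>2) \<le> real r + 2 * \<epsilon>"
    using sq[OF m] sq[OF p] near by (simp add: turan_number_def)
  moreover have "(real (part_size n p i) - b)\<^sup>2 \<le> (\<Sum>i<r. (real (part_size n p i) - b)\<^sup>2)"
    using assms(3) by (intro member_le_sum) auto
  ultimately have "(real (part_size n p i) - b)\<^sup>2 \<le> (real n / (2 * real r))\<^sup>2" using n by linarith
  then have "\<bar>real (part_size n p i) - b\<bar> \<le> real n / (2 * real r)"
    by (metis abs_le_square_iff abs_of_nonneg divide_nonneg_nonneg mult_nonneg_nonneg of_nat_0_le_iff zero_le_numeral)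
  moreover have "b = 2 * (real n / (2 * real r))" by (simp add: b_def)
  ultimately show ?thesis by linarith
qed

text \<open>A part below \<open>n div r\<close> would force all parts to be at most
  \<open>n div r\<close>, and a part above \<open>n div r + 1\<close> would force all parts to be at
  least \<open>n div r + 1\<close>; either way the sizes cannot sum to n.\<close>

lemma part_size_near_equal:
  assumes "r > 0" and p: "\<forall>v<n. p v < r"
    and close: "\<And>i j. i < r \<Longrightarrow> j < r \<Longrightarrow> part_size n p i \<le> Suc (part_size n p j)" and "i < r"
  shows "part_size n p i \<in> {n div r, Suc (n div r)}"
proof (rule ccontr)
  assume "\<not> ?thesis"
  then consider "part_size n p i < n div r" | "part_size n p i > Suc (n div r)" by force
  then show False
  proof cases
    case 1
    then have "(\<Sum>j<r. part_size n p j) < (\<Sum>j<r. n div r)"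
    proof (intro sum_strict_mono_ex1 ballI bexI[of _ i])
      fix j assume "j \<in> {..<r}"
      then show "part_size n p j \<le> n div r" using close[of j i] \<open>i < r\<close> 1 by simp
    qed (use 1 \<open>i < r\<close> in auto)
    then show False using sum_part_size[OF p] by (simp add: leD mult.commute[of r])
  next
    case 2
    then have "(\<Sum>j<r. Suc (n div r)) < (\<Sum>j<r. part_size n p j)"
    proof (intro sum_strict_mono_ex1 ballI bexI[of _ i])
      fix j assume "j \<in> {..<r}"
      then show "Suc (n div r) \<le> part_size n p j" using close[of i j] \<open>i < r\<close> 2 by simp
    qed (use 2 \<open>i < r\<close> in auto)
    then show False using sum_part_size[OF p] dividend_less_div_times[of r n] \<open>r > 0\<close>
      by (simp add: mult.commute[of r])
  qed
qed

lemma balanced_partitionI: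
  assumes "r > 0" and p: "\<forall>v<n. p v < r"
    and s: "\<And>i. i < r \<Longrightarrow> part_size n p i \<in> {n div r, Suc (n div r)}"
  shows "balanced_partition r n p"
proof -
  have "part_size n p i \<in> {n div r, (n + r - 1) div r}" if "i < r" for i
  proof (cases "n mod r = 0")
    case False
    have "(n + r - 1) div r = Suc (n div r)"
    proof -
      have "n + r - 1 = (n mod r - 1) + Suc (n div r) * r"
        using False assms(1) div_mult_mod_eq[of n r] mult_Suc[of "n div r" r] by linarith
      moreover have "(n mod r - 1) div r = 0" using assms(1) by (simp add: less_imp_diff_less)
      moreover have "((n mod r - 1) + Suc (n div r) * r) div r = Suc (n div r) + (n mod r - 1) div r"
        using assms(1) by (intro div_mult_self1) auto
      ultimately show ?thesis by (metis add_0_right)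
    qed
    then show ?thesis using s[OF that] by auto
  next
    \<comment> \<open>If r divides n, floor and ceiling coincide, so the size
      \<open>n div r + 1\<close> has to be excluded: no part is smaller than the mean, hence none is
      larger.\<close>
    case True
    show ?thesis
    proof (rule ccontr)
      assume "\<not> ?thesis"
      then have "part_size n p i > n div r" using s[OF that] by auto
      then have "(\<Sum>j<r. n div r) < (\<Sum>j<r. part_size n p j)"
      proof (intro sum_strict_mono_ex1 ballI bexI[of _ i])
        fix j assume "j \<in> {..<r}"
        then show "n div r \<le> part_size n p j" using s[of j] by auto
      qed (use that in auto)
      moreover have "(\<Sum>j<r. n div r) = n" using True by (auto simp: mod_eq_0_iff_dvd)
      ultimately show False using sum_part_size[OF p] by simp
    qed
  qed
  then show ?thesis using p by (auto simp: balanced_partition_def part_size_def)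
qed

text \<open>The move changes the sum of the squared part sizes by 2 (s_j - s_i) + 2, which is at
  most -2.\<close>

lemma card_turan_edges_move:
  assumes p: "\<forall>v<n. p v < r" and "v < n" "j < r" "p v = i"
    and big: "part_size n p i \<ge> part_size n p j + 2"
  shows "card (turan_edges n (p(v := j))) > card (turan_edges n p)"
proof -
  let ?p' = "p(v := j)"
  have ij: "i \<noteq> j" "i < r" using big assms by auto
  have p': "\<forall>v<n. ?p' v < r" using p assms by auto
  have "{x. x < n \<and> ?p' x = i} = {x. x < n \<and> p x = i} - {v}" using ij assms by auto
  then have si: "part_size n p i = Suc (part_size n ?p' i)"
    unfolding part_size_def using assms by (simp only:) (intro card.remove, auto)
  have "{x. x < n \<and> ?p' x = j} = insert v {x. x < n \<and> p x = j}" using ij assms by auto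
  then have sj: "part_size n ?p' j = Suc (part_size n p j)"
    unfolding part_size_def using assms ij by (simp only:) (intro card_insert_disjoint, auto)
  have sk: "part_size n ?p' k = part_size n p k" if "k \<noteq> i" "k \<noteq> j" for k
  proof -
    have "{x. x < n \<and> ?p' x = k} = {x. x < n \<and> p x = k}" using that assms by auto
    then show ?thesis by (simp add: part_size_def)
  qed
  have split: "(\<Sum>k<r. g k) = g i + g j + (\<Sum>k\<in>{..<r} - {i, j}. g k)" for g :: "nat \<Rightarrow> nat"
  proof -
    have "(\<Sum>k<r. g k) = (\<Sum>k\<in>{..<r} - {i, j}. g k) + (\<Sum>k\<in>{i, j}. g k)"
      using ij assms by (intro sum.subset_diff) auto
    then show ?thesis using ij by simp
  qed
  have "(\<Sum>k\<in>{..<r} - {i, j}. part_size n ?p' k ^ 2) = (\<Sum>k\<in>{..<r} - {i, j}. part_size n p k ^ 2)"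
    by (intro sum.cong) (auto simp: sk)
  then have "(\<Sum>k<r. part_size n ?p' k ^ 2) < (\<Sum>k<r. part_size n p k ^ 2)"
    unfolding split using si sj big by (simp add: power2_eq_square)
  then show ?thesis using card_turan_edges[OF p] card_turan_edges[OF p'] by linarith
qed

text \<open>Union bound in place of a counting lemma: there are at least (\<alpha> n)^|U| maps, and
  for each of the at most |U|^2 ordered pairs of vertices, at most |R| n^(|U|-2) maps send that pair
  into \<open>R\<close>.\<close>

lemma many_avoiding:
  fixes \<alpha> \<epsilon> :: real
  assumes U: "finite U" and W: "\<And>v. v \<in> U \<Longrightarrow> W v \<subseteq> {..<n} \<and> \<alpha> * real n \<le> real (card (W v))"
    and \<alpha>: "\<alpha> \<ge> 0" "\<epsilon> \<ge> 0" and R: "finite R" "real (card R) \<le> \<epsilon> * real n ^ 2"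
  shows "(\<alpha> ^ card U - real (card U) ^ 2 * \<epsilon>) * real n ^ card U \<le>
    real (card {\<phi> \<in> PiE U W. \<forall>v\<in>U. \<forall>w\<in>U. v \<noteq> w \<longrightarrow> (\<phi> v, \<phi> w) \<notin> R})"
proof -
  define G where "G = {\<phi> \<in> PiE U W. \<forall>v\<in>U. \<forall>w\<in>U. v \<noteq> w \<longrightarrow> (\<phi> v, \<phi> w) \<notin> R}"
  define B where "B = (\<lambda>(v, w). {\<phi> \<in> PiE U W. (\<phi> v, \<phi> w) \<in> R})"
  define J where "J = {(v, w) \<in> U \<times> U. v \<noteq> w}"
  have finW: "finite (W v)" if "v \<in> U" for v using W[OF that] finite_subset by blast
  have finP: "finite (PiE U W)" using U finW by (intro finite_PiE) auto
  have finJ: "finite J" unfolding J_def by (rule finite_subset[of _ "U \<times> U"]) (use U in auto)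
  have cJ: "card J \<le> card U ^ 2"
  proof -
    have "card J \<le> card (U \<times> U)" unfolding J_def using U by (intro card_mono) auto
    then show ?thesis by (simp add: card_cartesian_product power2_eq_square)
  qed
  have B: "real (card (B j)) \<le> \<epsilon> * real n ^ card U" if jJ: "j \<in> J" for j
  proof -
    obtain v w where j: "j = (v, w)" "v \<in> U" "w \<in> U" "v \<noteq> w" using jJ by (auto simp: J_def)
    define U' where "U' = U - {v, w}"
    \<comment> \<open>A map that is bad for (v, w) is determined by its pair in \<open>R\<close> and
      its values on the remaining vertices.\<close>
    define g where "g = (\<lambda>\<phi> :: 'a \<Rightarrow> nat. ((\<phi> v, \<phi> w), restrict \<phi> U'))"
    have U2: "card {v, w} \<le> card U" using j U by (intro card_mono) auto
    have cU': "card U' = card U - 2" using j U by (simp add: U'_def card_Diff_subset)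
    have "card (B j) \<le> card (R \<times> (U' \<rightarrow>\<^sub>E {..<n}))"
    proof (rule card_inj_on_le[of g])
      show "inj_on g (B j)"
      proof (rule inj_onI)
        fix \<phi> \<psi> assume a: "\<phi> \<in> B j" "\<psi> \<in> B j" "g \<phi> = g \<psi>"
        then have e: "\<phi> \<in> PiE U W" "\<psi> \<in> PiE U W" "\<phi> v = \<psi> v" "\<phi> w = \<psi> w" "restrict \<phi> U' = restrict \<psi> U'"
          by (auto simp: B_def j g_def)
        show "\<phi> = \<psi>"
        proof (rule PiE_ext[OF e(1,2)])
          fix x assume "x \<in> U"
          then show "\<phi> x = \<psi> x" using e(3,4) fun_cong[OF e(5), of x] by (cases "x \<in> U'") (auto simp: U'_def)
        qed
      qed
      show "g ` B j \<subseteq> R \<times> (U' \<rightarrow>\<^sub>E {..<n})"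
      proof (rule image_subsetI)
        fix \<phi> assume a: "\<phi> \<in> B j"
        then have "\<phi> x < n" if "x \<in> U" for x using W[OF that] that by (auto simp: B_def j PiE_iff)
        moreover have "(\<phi> v, \<phi> w) \<in> R" using a by (simp add: B_def j)
        ultimately show "g \<phi> \<in> R \<times> (U' \<rightarrow>\<^sub>E {..<n})" by (simp add: g_def U'_def)
      qed
      show "finite (R \<times> (U' \<rightarrow>\<^sub>E {..<n}))" using R U by (auto simp: U'_def intro!: finite_PiE)
    qed
    also have "\<dots> = card R * n ^ (card U - 2)"
      using U by (simp add: card_cartesian_product card_PiE U'_def flip: cU')
    finally have "real (card (B j)) \<le> real (card R) * real n ^ (card U - 2)"
      by (metis of_nat_le_iff of_nat_mult of_nat_power)
    also have "\<dots> \<le> \<epsilon> * real n ^ 2 * real n ^ (card U - 2)" using R(2) by (intro mult_right_mono) auto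
    also have "\<dots> = \<epsilon> * real n ^ (2 + (card U - 2))" by (simp only: power_add mult.assoc)
    also have "2 + (card U - 2) = card U" using U2 j by simp
    finally show ?thesis .
  qed
  have "PiE U W \<subseteq> G \<union> (\<Union>j\<in>J. B j)" by (auto simp: G_def B_def J_def)
  then have "card (PiE U W) \<le> card (G \<union> (\<Union>j\<in>J. B j))"
    using finP finJ by (intro card_mono) (auto simp: G_def B_def)
  also have "\<dots> \<le> card G + card (\<Union>j\<in>J. B j)" by (rule card_Un_le)
  also have "\<dots> \<le> card G + (\<Sum>j\<in>J. card (B j))" using finJ by (intro add_left_mono card_UN_le)
  finally have "real (card (PiE U W)) \<le> real (card G) + (\<Sum>j\<in>J. real (card (B j)))"
    by (metis of_nat_add of_nat_le_iff of_nat_sum)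
  moreover have "(\<Sum>j\<in>J. real (card (B j))) \<le> real (card U) ^ 2 * \<epsilon> * real n ^ card U"
  proof -
    have "(\<Sum>j\<in>J. real (card (B j))) \<le> real (card J) * (\<epsilon> * real n ^ card U)"
      using B by (intro sum_bounded_above) auto
    also have "\<dots> \<le> real (card U ^ 2) * (\<epsilon> * real n ^ card U)"
      using \<alpha>(2) cJ by (intro mult_right_mono of_nat_mono) auto
    finally show ?thesis by simp
  qed
  moreover have "(\<alpha> * real n) ^ card U \<le> real (card (PiE U W))"
  proof -
    have "(\<alpha> * real n) ^ card U = (\<Prod>v\<in>U. \<alpha> * real n)" by simp
    also have "\<dots> \<le> (\<Prod>v\<in>U. real (card (W v)))" using W \<alpha> by (intro prod_mono) auto
    also have "\<dots> = real (card (PiE U W))" using U by (simp add: card_PiE)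
    finally show ?thesis .
  qed
  ultimately show ?thesis by (simp add: G_def[symmetric] power_mult_distrib algebra_simps)
qed

subsection \<open>Embeddings and copies\<close>

definition embs :: "'a set \<Rightarrow> 'a set set \<Rightarrow> nat \<Rightarrow> nat set set \<Rightarrow> ('a \<Rightarrow> nat) set" where
  "embs VF EF n E = {\<phi> \<in> VF \<rightarrow>\<^sub>E {..<n}. inj_on \<phi> VF \<and> (\<forall>e\<in>EF. \<phi> ` e \<in> E)}"

definition copy_of :: "'a set \<Rightarrow> 'a set set \<Rightarrow> ('a \<Rightarrow> nat) \<Rightarrow> nat set \<times> nat set set" where
  "copy_of VF EF \<phi> = (\<phi> ` VF, (\<lambda>e. \<phi> ` e) ` EF)"

text \<open>Turns subgraphs into images of functions, which can be counted.
  \<open>isomorphic\<close> only compares pairs of vertices and says nothing about larger members of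
  \<open>E'\<close>; these are ruled out because \<open>E\<close> consists of two-element
  sets.\<close>

lemma copies_eq_image_embs:
  assumes F: "graph VF EF" and E: "E \<subseteq> all_edges n"
  shows "copies VF EF n E = copy_of VF EF ` embs VF EF n E"
proof (intro set_eqI iffI)
  fix z assume z: "z \<in> copies VF EF n E"
  obtain V' E' where z': "z = (V', E')" by (cases z)
  have V': "V' \<subseteq> {0..<n}" "E' \<subseteq> E" "\<forall>e\<in>E'. e \<subseteq> V'" using z by (auto simp: z' copies_def)
  obtain f where f: "bij_betw f VF V'" "\<forall>x\<in>VF. \<forall>y\<in>VF. {x, y} \<in> EF \<longleftrightarrow> {f x, f y} \<in> E'"
    using z by (auto simp: z' copies_def isomorphic_def)
  define \<phi> where "\<phi> = restrict f VF"
  have \<phi>im: "\<phi> ` e = f ` e" if "e \<subseteq> VF" for e using that by (auto simp: \<phi>_def image_iff subset_iff)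
  have fV: "f ` VF = V'" "inj_on f VF" using f(1) by (auto simp: bij_betw_def)
  have EFsub: "e \<subseteq> VF" if "e \<in> EF" for e using F that by (auto simp: graph_def)
  have pair: "f ` e \<in> E'" if e: "e \<in> EF" for e
  proof -
    have "card e = 2" using F e by (simp add: graph_def)
    then obtain x y where "e = {x, y}" by (auto simp: card_2_iff)
    then show ?thesis using f(2) e EFsub[OF e] by auto
  qed
  have E'eq: "E' = (\<lambda>e. \<phi> ` e) ` EF"
  proof (intro set_eqI iffI)
    fix e' assume e': "e' \<in> E'"
    then have "e' \<in> all_edges n" using V'(2) E by auto
    then obtain a b where ab: "e' = {a, b}" by (auto elim: all_edges_pairE)
    then have "a \<in> f ` VF" "b \<in> f ` VF" using e' V'(3) fV by auto
    then obtain x y where xy: "x \<in> VF" "y \<in> VF" "a = f x" "b = f y" by blast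
    then have "{x, y} \<in> EF" using f(2) e' ab by auto
    moreover have "e' = \<phi> ` {x, y}" using xy ab by (simp add: \<phi>_def)
    ultimately show "e' \<in> (\<lambda>e. \<phi> ` e) ` EF" by blast
  next
    fix e' assume "e' \<in> (\<lambda>e. \<phi> ` e) ` EF"
    then show "e' \<in> E'" using pair EFsub \<phi>im by auto
  qed
  have "\<phi> \<in> embs VF EF n E"
  proof -
    have "inj_on \<phi> VF" using fV(2) by (simp add: \<phi>_def inj_on_def)
    moreover have "\<phi> \<in> VF \<rightarrow>\<^sub>E {..<n}" using fV(1) V'(1) by (auto simp: \<phi>_def)
    moreover have "\<forall>e\<in>EF. \<phi> ` e \<in> E" using E'eq V'(2) by auto
    ultimately show ?thesis by (simp add: embs_def)
  qed
  moreover have "z = copy_of VF EF \<phi>" using E'eq \<phi>im[of VF] fV by (simp add: z' copy_of_def)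
  ultimately show "z \<in> copy_of VF EF ` embs VF EF n E" by blast
next
  fix z assume "z \<in> copy_of VF EF ` embs VF EF n E"
  then obtain \<phi> where \<phi>: "z = copy_of VF EF \<phi>" "\<phi> \<in> VF \<rightarrow>\<^sub>E {..<n}" "inj_on \<phi> VF" "\<forall>e\<in>EF. \<phi> ` e \<in> E"
    by (auto simp: embs_def)
  have EFsub: "e \<subseteq> VF" if "e \<in> EF" for e using F that by (auto simp: graph_def)
  have iff: "{x, y} \<in> EF \<longleftrightarrow> {\<phi> x, \<phi> y} \<in> (\<lambda>e. \<phi> ` e) ` EF" if "x \<in> VF" "y \<in> VF" for x y
  proof
    assume "{x, y} \<in> EF"
    then show "{\<phi> x, \<phi> y} \<in> (\<lambda>e. \<phi> ` e) ` EF" by (intro image_eqI[of _ _ "{x, y}"]) auto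
  next
    assume "{\<phi> x, \<phi> y} \<in> (\<lambda>e. \<phi> ` e) ` EF"
    then obtain e where e: "e \<in> EF" "\<phi> ` {x, y} = \<phi> ` e" by auto
    then have "{x, y} = e" using inj_on_image_eq_iff[OF \<phi>(3), of "{x, y}" e] that EFsub by auto
    then show "{x, y} \<in> EF" using e by simp
  qed
  have "isomorphic VF EF (\<phi> ` VF) ((\<lambda>e. \<phi> ` e) ` EF)"
    unfolding isomorphic_def using \<phi>(3) iff by (intro exI[of _ \<phi>]) (auto simp: bij_betw_def)
  moreover have "\<phi> ` VF \<subseteq> {0..<n}" using \<phi>(2) by auto
  ultimately show "z \<in> copies VF EF n E"
    using \<phi>(4) image_mono[OF EFsub, of _ \<phi>] unfolding \<phi>(1) copies_def copy_of_def by auto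
qed

lemma finite_embs: "finite VF \<Longrightarrow> finite (embs VF EF n E)"
  unfolding embs_def by (rule finite_subset[of _ "VF \<rightarrow>\<^sub>E {..<n}"]) (auto intro: finite_PiE)

lemma finite_copies:
  assumes "graph VF EF" and "E \<subseteq> all_edges n" shows "finite (copies VF EF n E)"
  using assms finite_embs[of VF] by (simp add: copies_eq_image_embs graph_def)

lemma copies_mono: "E \<subseteq> E' \<Longrightarrow> copies VF EF n E \<subseteq> copies VF EF n E'"
  by (auto simp: copies_def)

text \<open>Embeddings with the same copy have the same image of size f, so at most f^f of them
  share a copy.\<close>

lemma card_embs_le_card_copies:
  assumes fin: "finite VF" and \<Phi>: "\<Phi> \<subseteq> embs VF EF n E"
  shows "card \<Phi> \<le> card VF ^ card VF * card (copy_of VF EF ` \<Phi>)"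
proof -
  have fin\<Phi>: "finite \<Phi>" using \<Phi> finite_embs[OF fin] finite_subset by blast
  let ?fib = "\<lambda>z. {\<phi> \<in> \<Phi>. copy_of VF EF \<phi> = z}"
  have "card (?fib z) \<le> card VF ^ card VF" if z: "z \<in> copy_of VF EF ` \<Phi>" for z
  proof -
    obtain \<psi> where \<psi>: "\<psi> \<in> \<Phi>" "z = copy_of VF EF \<psi>" using z by blast
    have "?fib z \<subseteq> VF \<rightarrow>\<^sub>E \<psi> ` VF"
    proof
      fix \<phi> assume "\<phi> \<in> ?fib z"
      then have "\<phi> ` VF = \<psi> ` VF" "\<phi> \<in> extensional VF"
        using \<Phi> \<psi>(2) by (auto simp: copy_of_def embs_def PiE_iff)
      then show "\<phi> \<in> VF \<rightarrow>\<^sub>E \<psi> ` VF" by (auto simp: PiE_iff)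
    qed
    then have "card (?fib z) \<le> card (VF \<rightarrow>\<^sub>E \<psi> ` VF)"
      using fin by (intro card_mono finite_PiE) auto
    also have "\<dots> = card (\<psi> ` VF) ^ card VF" using fin by (simp add: card_PiE)
    also have "\<dots> = card VF ^ card VF" using \<psi> \<Phi> by (auto simp: embs_def card_image)
    finally show ?thesis .
  qed
  moreover have "card \<Phi> \<le> (\<Sum>z\<in>copy_of VF EF ` \<Phi>. card (?fib z))"
  proof -
    have "\<Phi> = (\<Union>z\<in>copy_of VF EF ` \<Phi>. ?fib z)" by auto
    then have "card \<Phi> = card (\<Union>z\<in>copy_of VF EF ` \<Phi>. ?fib z)" by simp
    also have "\<dots> \<le> (\<Sum>z\<in>copy_of VF EF ` \<Phi>. card (?fib z))" using fin\<Phi> by (intro card_UN_le) auto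
    finally show ?thesis .
  qed
  ultimately show ?thesis
    using sum_bounded_above[of "copy_of VF EF ` \<Phi>" "\<lambda>z. card (?fib z)" "card VF ^ card VF"]
    by (simp add: mult.commute)
qed

text \<open>Such a copy comes from an embedding that sends some set \<open>S\<close> of at least s
  vertices into some \<open>X\<close>. There are at most 2^f sets \<open>S\<close>, at most 4^f ways
  to map \<open>S\<close> into \<open>X\<close>, and at most n^(f-s) ways for the rest, whence 8^f.
  The bound 4 on \<open>X\<close> covers an edge, an edge with a further vertex, and the union of
  two edges.\<close>

lemma card_copies_hitting:
  assumes F: "graph VF EF" and E: "E \<subseteq> all_edges n" and n: "n > 0"
    and XX: "finite XX" "\<And>X. X \<in> XX \<Longrightarrow> finite X \<and> card X \<le> 4"
  shows "card {z \<in> copies VF EF n E. \<exists>X\<in>XX. card (fst z \<inter> X) \<ge> s} \<le> card XX * 8 ^ card VF * n ^ (card VF - s)"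
proof -
  define SS where "SS = {S. S \<subseteq> VF \<and> card S \<ge> s}"
  define P where "P = (\<lambda>X S. {\<phi> \<in> VF \<rightarrow>\<^sub>E {..<n}. \<phi> ` S \<subseteq> X})"
  have finite_VF: "finite VF" using F by (simp add: graph_def)
  have finP: "finite (P X S)" for X S
    unfolding P_def by (rule finite_subset[of _ "VF \<rightarrow>\<^sub>E {..<n}"]) (use finite_VF in \<open>auto intro: finite_PiE\<close>)
  have finSS: "finite SS" unfolding SS_def by (rule finite_subset[of _ "Pow VF"]) (use finite_VF in auto)
  have cSS: "card SS \<le> 2 ^ card VF"
    using card_mono[of "Pow VF" SS] finite_VF by (auto simp: SS_def card_Pow)
  have cP: "card (P X S) \<le> 4 ^ card VF * n ^ (card VF - s)" if "X \<in> XX" "S \<in> SS" for X S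
  proof -
    have S: "S \<subseteq> VF" "card S \<ge> s" "finite S" using that finite_VF by (auto simp: SS_def intro: finite_subset)
    have cS: "card S \<le> card VF" using S finite_VF by (intro card_mono)
    have "P X S \<subseteq> PiE VF (\<lambda>v. if v \<in> S then X else {..<n})"
      by (auto simp: P_def PiE_iff extensional_def image_subset_iff)
    then have "card (P X S) \<le> card (PiE VF (\<lambda>v. if v \<in> S then X else {..<n}))"
      using finite_VF XX(2)[OF that(1)] by (intro card_mono finite_PiE) auto
    also have "\<dots> = (\<Prod>v\<in>VF. if v \<in> S then card X else n)"
      using finite_VF by (simp add: card_PiE if_distrib cong: if_cong)
    also have "\<dots> = card X ^ card S * n ^ (card VF - card S)"
    proof -
      have "VF \<inter> S = S" using S by auto
      moreover have "VF \<inter> - S = VF - S" by auto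
      ultimately show ?thesis using finite_VF S by (simp add: prod.If_cases card_Diff_subset)
    qed
    also have "\<dots> \<le> 4 ^ card VF * n ^ (card VF - s)"
    proof (rule mult_le_mono)
      have "card X ^ card S \<le> 4 ^ card S" using XX(2)[OF that(1)] by (intro power_mono) auto
      also have "\<dots> \<le> 4 ^ card VF" using cS by (intro power_increasing) auto
      finally show "card X ^ card S \<le> 4 ^ card VF" .
      show "n ^ (card VF - card S) \<le> n ^ (card VF - s)" using n S by (intro power_increasing) auto
    qed
    finally show ?thesis .
  qed
  have "{z \<in> copies VF EF n E. \<exists>X\<in>XX. card (fst z \<inter> X) \<ge> s} \<subseteq> copy_of VF EF ` (\<Union>X\<in>XX. \<Union>S\<in>SS. P X S)"
  proof clarify
    fix V' E' X assume a: "(V', E') \<in> copies VF EF n E" "X \<in> XX" "card (fst (V', E') \<inter> X) \<ge> s"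
    then obtain \<phi> where \<phi>: "\<phi> \<in> embs VF EF n E" "(V', E') = copy_of VF EF \<phi>"
      using copies_eq_image_embs[OF F E] by auto
    define S where "S = {v \<in> VF. \<phi> v \<in> X}"
    have "\<phi> ` S = V' \<inter> X" using \<phi> by (auto simp: S_def copy_of_def)
    then have "card S \<ge> s" using a(3) card_image_le[of S \<phi>] finite_VF by (auto simp: S_def)
    then have "S \<in> SS" by (auto simp: SS_def S_def)
    moreover have "\<phi> \<in> P X S" using \<phi> by (auto simp: P_def S_def embs_def)
    ultimately show "(V', E') \<in> copy_of VF EF ` (\<Union>X\<in>XX. \<Union>S\<in>SS. P X S)"
      using a(2) \<phi>(2) by blast
  qed
  then have "card {z \<in> copies VF EF n E. \<exists>X\<in>XX. card (fst z \<inter> X) \<ge> s} \<le> card (copy_of VF EF ` (\<Union>X\<in>XX. \<Union>S\<in>SS. P X S))"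
    using XX finSS finP by (intro card_mono) auto
  also have "\<dots> \<le> card (\<Union>X\<in>XX. \<Union>S\<in>SS. P X S)" using XX finSS finP by (intro card_image_le) auto
  also have "\<dots> \<le> (\<Sum>X\<in>XX. card (\<Union>S\<in>SS. P X S))" using XX by (intro card_UN_le) auto
  also have "\<dots> \<le> (\<Sum>X\<in>XX. \<Sum>S\<in>SS. card (P X S))" using finSS by (intro sum_mono card_UN_le) auto
  also have "\<dots> \<le> (\<Sum>X\<in>XX. \<Sum>S\<in>SS. 4 ^ card VF * n ^ (card VF - s))" using cP by (intro sum_mono)
  also have "\<dots> = card XX * (card SS * (4 ^ card VF * n ^ (card VF - s)))" by simp
  also have "\<dots> \<le> card XX * (2 ^ card VF * (4 ^ card VF * n ^ (card VF - s)))"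
    using cSS by (intro mult_le_mono) auto
  also have "\<dots> = card XX * (2 * 4) ^ card VF * n ^ (card VF - s)"
    by (simp only: power_mult_distrib mult.assoc)
  finally show ?thesis by simp
qed

subsection \<open>Copies through a vertex or a bad edge\<close>

text \<open>\<open>c\<close> is an \<open>r\<close>-colouring of \<open>F\<close> without its critical edge \<open>{u, v}\<close>.\<close>

locale colour_critical =
  fixes VF :: "'a set" and EF :: "'a set set" and r :: nat and c :: "'a \<Rightarrow> nat" and u v :: 'a
  assumes r: "r \<ge> 2" and F: "graph VF EF" and uv: "u \<noteq> v" "{u, v} \<in> EF"
    and col: "\<And>x. x \<in> VF \<Longrightarrow> c x < r"
    and proper: "\<And>x y. {x, y} \<in> EF \<Longrightarrow> x \<noteq> y \<Longrightarrow> {x, y} \<noteq> {u, v} \<Longrightarrow> c x \<noteq> c y"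
    and not_colorable: "\<not> colorable VF EF r"
    and card_VF: "card VF \<ge> 3"
begin

lemma finite_VF: "finite VF" using F by (simp add: graph_def)

lemma edge_sub: "e \<in> EF \<Longrightarrow> e \<subseteq> VF" using F by (auto simp: graph_def)

lemma edge_pairE:
  assumes "e \<in> EF" obtains a b where "e = {a, b}" "a \<noteq> b" "a \<in> VF" "b \<in> VF"
proof -
  have "card e = 2" using F assms by (simp add: graph_def)
  then obtain a b where "e = {a, b}" "a \<noteq> b" by (auto simp: card_2_iff)
  then show ?thesis using that edge_sub[OF assms] by auto
qed

lemma uvV: "u \<in> VF" "v \<in> VF" using edge_sub[OF uv(2)] by auto

lemma same_colour: "c u = c v"
proof (rule ccontr)
  assume ne: "c u \<noteq> c v"
  have "c x \<noteq> c y" if "e \<in> EF" "x \<in> e" "y \<in> e" "x \<noteq> y" for e x y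
  proof -
    obtain a b where "e = {a, b}" "a \<noteq> b" using edge_pairE[OF \<open>e \<in> EF\<close>] by metis
    then have "e = {x, y}" using that by auto
    then show ?thesis using proper[of x y] that ne by (cases "{x, y} = {u, v}") (auto simp: doubleton_eq_iff)
  qed
  then have "colorable VF EF r" unfolding colorable_def using col by (intro exI[of _ c]) auto
  then show False using not_colorable by simp
qed

text \<open>Composing an embedding with \<open>p\<close> would r-colour F.\<close>

lemma turan_copies_empty:
  assumes p: "\<forall>x<n. p x < r"
  shows "copies VF EF n (turan_edges n p) = {}"
proof -
  have "embs VF EF n (turan_edges n p) = {}"
  proof (rule ccontr)
    assume "\<not> ?thesis"
    then obtain \<phi> where \<phi>: "\<phi> \<in> VF \<rightarrow>\<^sub>E {..<n}" "inj_on \<phi> VF" "\<forall>e\<in>EF. \<phi> ` e \<in> turan_edges n p"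
      by (auto simp: embs_def)
    have "p (\<phi> x) \<noteq> p (\<phi> y)" if "e \<in> EF" "x \<in> e" "y \<in> e" "x \<noteq> y" for e x y
    proof -
      have "\<phi> x \<noteq> \<phi> y" using \<phi>(2) edge_sub[OF that(1)] that by (auto simp: inj_on_def)
      moreover have "\<phi> ` e \<in> turan_edges n p" using \<phi>(3) that by auto
      ultimately show ?thesis using that by (auto simp: turan_edges_def)
    qed
    moreover have "\<forall>x\<in>VF. p (\<phi> x) < r" using p \<phi>(1) by auto
    ultimately have "colorable VF EF r"
      unfolding colorable_def by (intro exI[of _ "\<lambda>x. p (\<phi> x)"]) auto
    then show False using not_colorable by simp
  qed
  then show ?thesis using copies_eq_image_embs[OF F turan_edges_subset] by auto
qed

lemma copy_has_bad_edge:
  assumes p: "\<forall>x<n. p x < r" and z: "z \<in> copies VF EF n E"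
  shows "\<exists>b\<in>E - turan_edges n p. b \<in> snd z \<and> b \<subseteq> fst z"
proof (rule ccontr)
  assume "\<not> ?thesis"
  moreover have "snd z \<subseteq> E" "\<forall>e\<in>snd z. e \<subseteq> fst z" using z unfolding copies_def by force+
  ultimately have "snd z \<subseteq> turan_edges n p" by blast
  then have "z \<in> copies VF EF n (turan_edges n p)" using z by (auto simp: copies_def)
  then show False using turan_copies_empty[OF p] by simp
qed

text \<open>Common frame of the two counting lemmas below: \<open>g\<close> fixes the images outside
  \<open>U\<close>, the vertices of \<open>U\<close> range over large candidate sets, and
  \<open>R\<close> lists the forbidden pairs of images. It contains the diagonal, so avoiding it
  makes the map injective on \<open>U\<close>. Most choices avoid \<open>R\<close>, different
  choices give different embeddings, and each copy in \<open>Z\<close> is hit at most f^f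
  times.\<close>

lemma extended_embeddings:
  fixes \<alpha> \<epsilon> :: real
  assumes U: "U \<subseteq> VF" and g: "g ` (VF - U) \<subseteq> {..<n}" "inj_on g (VF - U)"
    and W: "\<And>w. w \<in> U \<Longrightarrow> W w \<subseteq> {..<n} - g ` (VF - U) \<and> \<alpha> * real n \<le> real (card (W w))"
    and \<alpha>: "0 < \<alpha>" "\<alpha> \<le> 1" "\<epsilon> \<ge> 0" "real (card VF) ^ 2 * \<epsilon> \<le> \<alpha> ^ card VF / 2"
    and R: "finite R" "real (card R) \<le> \<epsilon> * real n ^ 2" "\<And>a. a < n \<Longrightarrow> (a, a) \<in> R"
    and Z: "finite Z"
    and ext: "\<And>\<phi>. \<phi> \<in> VF \<rightarrow>\<^sub>E {..<n} \<Longrightarrow> (\<And>w. w \<in> U \<Longrightarrow> \<phi> w \<in> W w) \<Longrightarrow> (\<And>w. w \<in> VF - U \<Longrightarrow> \<phi> w = g w) \<Longrightarrow>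
       (\<And>w w'. w \<in> U \<Longrightarrow> w' \<in> U \<Longrightarrow> w \<noteq> w' \<Longrightarrow> (\<phi> w, \<phi> w') \<notin> R) \<Longrightarrow> inj_on \<phi> VF \<Longrightarrow>
       (\<forall>e\<in>EF. \<phi> ` e \<in> E) \<and> copy_of VF EF \<phi> \<in> Z"
  shows "\<alpha> ^ card VF / 2 * real n ^ card U \<le> real (card VF ^ card VF) * real (card Z)"
proof -
  define G where "G = {\<phi> \<in> PiE U W. \<forall>v\<in>U. \<forall>w\<in>U. v \<noteq> w \<longrightarrow> (\<phi> v, \<phi> w) \<notin> R}"
  \<comment> \<open>Outside \<open>VF\<close> the glued map has to be \<open>undefined\<close>, as
    the elements of \<open>embs\<close> are extensional.\<close>
  define x where "x = (\<lambda>\<phi> w. if w \<in> U then \<phi> w else if w \<in> VF then g w else undefined)"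
  have finU: "finite U" using U finite_VF finite_subset by blast
  have cU: "card U \<le> card VF" using U finite_VF by (intro card_mono)
  \<comment> \<open>As \<alpha> is at most 1, passing from |U| to f weakens the main term and
    strengthens the loss; \<epsilon> is small enough for the loss to be at most half.\<close>
  have "\<alpha> ^ card VF / 2 \<le> \<alpha> ^ card U - real (card U) ^ 2 * \<epsilon>"
  proof -
    have "\<alpha> ^ card VF \<le> \<alpha> ^ card U" using \<alpha> cU by (intro power_decreasing) auto
    moreover have "real (card U) ^ 2 * \<epsilon> \<le> real (card VF) ^ 2 * \<epsilon>"
      using \<alpha> cU by (intro mult_right_mono power_mono) auto
    ultimately show ?thesis using \<alpha>(4) by linarith
  qed
  then have "\<alpha> ^ card VF / 2 * real n ^ card U \<le> (\<alpha> ^ card U - real (card U) ^ 2 * \<epsilon>) * real n ^ card U"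
    by (intro mult_right_mono) auto
  also have "\<dots> \<le> real (card G)"
    unfolding G_def using W \<alpha> by (intro many_avoiding finU R(1,2)) auto
  finally have 1: "\<alpha> ^ card VF / 2 * real n ^ card U \<le> real (card G)" .
  have xprops: "x \<phi> \<in> embs VF EF n E \<and> copy_of VF EF (x \<phi>) \<in> Z" if \<phi>: "\<phi> \<in> G" for \<phi>
  proof -
    have \<phi>W: "\<phi> w \<in> W w" if "w \<in> U" for w using \<phi> that by (auto simp: G_def)
    have xU: "x \<phi> w = \<phi> w" if "w \<in> U" for w using that by (simp add: x_def)
    have xg: "x \<phi> w = g w" if "w \<in> VF - U" for w using that by (simp add: x_def)
    have lt: "x \<phi> w < n" if "w \<in> VF" for w
      using \<phi>W[of w] W[of w] g(1) that by (cases "w \<in> U") (auto simp: x_def)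
    then have xn: "x \<phi> \<in> VF \<rightarrow>\<^sub>E {..<n}" using U by (auto simp: x_def)
    have xR: "(x \<phi> w, x \<phi> w') \<notin> R" if "w \<in> U" "w' \<in> U" "w \<noteq> w'" for w w'
      using that \<phi> by (auto simp: xU G_def)
    have inj: "inj_on (x \<phi>) VF"
    proof (rule inj_onI, rule ccontr)
      fix a b assume ab: "a \<in> VF" "b \<in> VF" "x \<phi> a = x \<phi> b" "a \<noteq> b"
      consider "a \<in> U" "b \<in> U" | "a \<in> U" "b \<notin> U" | "a \<notin> U" "b \<in> U" | "a \<notin> U" "b \<notin> U" by blast
      then show False
      proof cases
        case 1
        then show False using xR[of a b] ab R(3)[OF lt[of b]] by auto
      next
        case 2
        then have "x \<phi> a \<in> W a" "x \<phi> b \<in> g ` (VF - U)" using \<phi>W[of a] xU[of a] xg[of b] ab(1,2) by auto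
        then show False using W[OF 2(1)] ab by auto
      next
        case 3
        then have "x \<phi> b \<in> W b" "x \<phi> a \<in> g ` (VF - U)" using \<phi>W[of b] xU[of b] xg[of a] ab(1,2) by auto
        then show False using W[OF 3(2)] ab by auto
      next
        case 4
        then show False using g(2) ab xg by (auto simp: inj_on_def)
      qed
    qed
    have "(\<forall>e\<in>EF. x \<phi> ` e \<in> E) \<and> copy_of VF EF (x \<phi>) \<in> Z"
      by (rule ext[OF xn _ _ _ inj]) (use xU \<phi>W xg xR in auto)
    then show ?thesis using xn inj by (simp add: embs_def)
  qed
  have "inj_on x G"
  proof (rule inj_onI)
    fix \<phi> \<psi> assume a: "\<phi> \<in> G" "\<psi> \<in> G" "x \<phi> = x \<psi>"
    have "\<phi> w = \<psi> w" if "w \<in> U" for w using fun_cong[OF a(3), of w] that by (simp add: x_def)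
    moreover have "\<phi> \<in> PiE U W" "\<psi> \<in> PiE U W" using a by (auto simp: G_def)
    ultimately show "\<phi> = \<psi>" by (meson PiE_ext)
  qed
  then have "card G = card (x ` G)" by (simp add: card_image)
  also have "\<dots> \<le> card VF ^ card VF * card (copy_of VF EF ` x ` G)"
    using xprops by (intro card_embs_le_card_copies finite_VF) blast
  also have "\<dots> \<le> card VF ^ card VF * card Z"
    using xprops Z by (intro mult_le_mono card_mono order_refl) blast+
  finally have "real (card G) \<le> real (card VF ^ card VF * card Z)" by (simp only: of_nat_le_iff)
  then show ?thesis using 1 by (simp only: of_nat_mult)
qed

text \<open>Used with \<open>M\<close> the set of missing cross edges, so that vertices in different
  parts which do not clash are adjacent.\<close>

definition clash :: "nat \<Rightarrow> nat set set \<Rightarrow> (nat \<times> nat) set" where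
  "clash n M = {(a, b). a < n \<and> b < n \<and> (a = b \<or> {a, b} \<in> M)}"

lemma finite_clash: "finite (clash n M)"
  unfolding clash_def by (rule finite_subset[of _ "{..<n} \<times> {..<n}"]) auto

lemma card_clash:
  assumes "M \<subseteq> all_edges n" shows "card (clash n M) \<le> n + 2 * card M"
proof -
  have "clash n M = (\<lambda>a. (a, a)) ` {..<n} \<union> arcs M {..<n} {..<n}"
    by (auto simp: clash_def arcs_def)
  then have "card (clash n M) \<le> card ((\<lambda>a. (a, a)) ` {..<n}) + card (arcs M {..<n} {..<n})"
    by (simp add: card_Un_le)
  also have "card ((\<lambda>a. (a, a)) ` {..<n}) \<le> n" using card_image_le[of "{..<n}" "\<lambda>a. (a, a)"] by simp
  finally show ?thesis using card_arcs[OF assms] by simp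
qed

text \<open>Place u at x and every other vertex among the neighbours of x in the part of its colour.
  The edges at u, including the critical one, are then present, and \<open>c\<close> is proper on
  the rest of F because the critical edge contains u. With one vertex fixed, f - 1 are free.\<close>

lemma vertex_copies:
  fixes \<beta> \<epsilon> :: real
  assumes E: "E \<subseteq> all_edges n" and x: "x < n"
    and deg: "\<And>i. i < r \<Longrightarrow> \<beta> * real n \<le> real (card {z. z < n \<and> p z = i \<and> {x, z} \<in> E})"
    and \<beta>: "0 < \<beta>" "\<beta> \<le> 1" "\<epsilon> \<ge> 0" "real (card VF) ^ 2 * \<epsilon> \<le> \<beta> ^ card VF / 2"
    and M: "real (n + 2 * card (turan_edges n p - E)) \<le> \<epsilon> * real n ^ 2"
  shows "\<beta> ^ card VF / 2 * real n ^ (card VF - 1) \<le> real (card VF ^ card VF) * real (num_copies VF EF n E)"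
proof -
  define M where "M = turan_edges n p - E"
  define U where "U = VF - {u}"
  have U: "U \<subseteq> VF" "VF - U = {u}" "card U = card VF - 1"
    using uvV finite_VF by (auto simp: U_def)
  have "real (card (clash n M)) \<le> \<epsilon> * real n ^ 2"
    using card_clash[of M n] assms(8) turan_edges_subset[of n p] unfolding M_def
    by (meson Diff_subset of_nat_mono order_trans)
  then have "\<beta> ^ card VF / 2 * real n ^ card U \<le> real (card VF ^ card VF) * real (card (copies VF EF n E))"
  proof (intro extended_embeddings[where R = "clash n M" and g = "\<lambda>_. x" and E = E and \<epsilon> = \<epsilon>
        and W = "\<lambda>w. {z. z < n \<and> p z = c w \<and> {x, z} \<in> E}"] U(1) \<beta> finite_clash finite_copies F E)
    show "(\<lambda>_. x) ` (VF - U) \<subseteq> {..<n}" using x by auto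
    show "inj_on (\<lambda>_. x) (VF - U)" by (simp add: U)
    show "{z. z < n \<and> p z = c w \<and> {x, z} \<in> E} \<subseteq> {..<n} - (\<lambda>_. x) ` (VF - U) \<and>
          \<beta> * real n \<le> real (card {z. z < n \<and> p z = c w \<and> {x, z} \<in> E})" if "w \<in> U" for w
      using deg[OF col[of w]] that E all_edges_iff[of x x n] by (auto simp: U_def)
    show "(a, a) \<in> clash n M" if "a < n" for a using that by (simp add: clash_def)
    fix \<phi> assume \<phi>: "\<phi> \<in> VF \<rightarrow>\<^sub>E {..<n}" "inj_on \<phi> VF"
      and W: "\<And>w. w \<in> U \<Longrightarrow> \<phi> w \<in> {z. z < n \<and> p z = c w \<and> {x, z} \<in> E}"
      and g: "\<And>w. w \<in> VF - U \<Longrightarrow> \<phi> w = x"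
      and R: "\<And>w w'. w \<in> U \<Longrightarrow> w' \<in> U \<Longrightarrow> w \<noteq> w' \<Longrightarrow> (\<phi> w, \<phi> w') \<notin> clash n M"
    have "\<phi> ` e \<in> E" if e: "e \<in> EF" for e
    proof -
      obtain a b where ab: "e = {a, b}" "a \<noteq> b" "a \<in> VF" "b \<in> VF" using edge_pairE[OF e] by metis
      have gu: "\<phi> u = x" using g[of u] by (simp add: U)
      consider "a = u" "b \<in> U" | "b = u" "a \<in> U" | "a \<in> U" "b \<in> U" using ab by (auto simp: U_def)
      then show ?thesis
      proof cases
        case 1 then show ?thesis using W[of b] gu ab by simp
      next
        case 2 then show ?thesis using W[of a] gu ab by (simp add: insert_commute)
      next
        case 3
        then have "{a, b} \<noteq> {u, v}" by (auto simp: U_def)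
        then have "c a \<noteq> c b" using proper e ab by auto
        then have "{\<phi> a, \<phi> b} \<in> turan_edges n p" using W[of a] W[of b] 3 by (simp add: turan_edges_iff)
        moreover have "{\<phi> a, \<phi> b} \<notin> M"
          using R[of a b] 3 ab W[of a] W[of b] by (simp add: clash_def)
        ultimately show ?thesis using ab by (simp add: M_def)
      qed
    qed
    moreover have "\<phi> \<in> embs VF EF n E" using \<phi> calculation by (simp add: embs_def)
    ultimately show "(\<forall>e\<in>EF. \<phi> ` e \<in> E) \<and> copy_of VF EF \<phi> \<in> copies VF EF n E"
      using copies_eq_image_embs[OF F E] by blast
  qed
  then show ?thesis by (simp add: num_copies_def U)
qed

text \<open>Place the critical edge on the bad edge and the remaining vertices in the parts of their
  colours, away from the vertices that x or y misses. Every other edge of F then becomes a cross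
  edge, so the copy has just one bad edge. This makes the copies for different bad edges disjoint,
  as is needed to sum over bad edges.\<close>

lemma bad_edge_copies:
  fixes \<alpha> \<epsilon> :: real
  assumes E: "E \<subseteq> all_edges n" and p: "\<forall>x<n. p x < r"
    and xy: "{x, y} \<in> E - turan_edges n p"
    and size: "\<And>i. i < r \<Longrightarrow> 2 * \<alpha> * real n \<le> real (part_size n p i)"
    and deg: "real (2 + card {z. {x, z} \<in> turan_edges n p - E} + card {z. {y, z} \<in> turan_edges n p - E}) \<le> \<alpha> * real n"
    and \<alpha>: "0 < \<alpha>" "\<alpha> \<le> 1" "\<epsilon> \<ge> 0" "real (card VF) ^ 2 * \<epsilon> \<le> \<alpha> ^ card VF / 2"
    and M: "real (n + 2 * card (turan_edges n p - E)) \<le> \<epsilon> * real n ^ 2"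
  shows "\<alpha> ^ card VF / 2 * real n ^ (card VF - 2) \<le> real (card VF ^ card VF) *
     real (card {z \<in> copies VF EF n E. snd z \<inter> (E - turan_edges n p) = {{x, y}}})"
proof -
  define M where "M = turan_edges n p - E"
  define U where "U = VF - {u, v}"
  have U: "U \<subseteq> VF" "VF - U = {u, v}" "card U = card VF - 2"
    using uvV finite_VF uv by (auto simp: U_def card_Diff_subset)
  have xyn: "x < n" "y < n" "x \<noteq> y" using xy E all_edges_iff[of x y n] by auto
  have pxy: "p x = p y" using xy xyn by (auto simp: turan_edges_iff)
  \<comment> \<open>The transposition of the colours \<open>c u\<close> and \<open>p x\<close>: the
    common colour of u and v has to be assigned to the part that contains x and y.\<close>
  define \<sigma> where "\<sigma> = (\<lambda>k. if k = c u then p x else if k = p x then c u else k)"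
  have \<sigma>inj: "\<sigma> a \<noteq> \<sigma> b" if "a \<noteq> b" for a b using that by (auto simp: \<sigma>_def)
  have \<sigma>r: "\<sigma> (c w) < r" if "w \<in> VF" for w using col[OF that] col[OF uvV(1)] p xyn by (auto simp: \<sigma>_def)
  \<comment> \<open>Vertices that may not be used besides x and y: those missing a cross edge to one
    of the two. At most \<alpha> n vertices are excluded, so each part of size 2 \<alpha> n retains
    \<alpha> n candidates.\<close>
  define X where "X = {x, y} \<union> {z. {x, z} \<in> M} \<union> {z. {y, z} \<in> M}"
  define g where "g = (\<lambda>w. if w = u then x else y)"
  have finN: "finite {z. {a, z} \<in> M}" for a
    by (rule finite_subset[of _ "{..<n}"]) (auto simp: M_def turan_edges_iff)
  have "card X \<le> card {x, y} + card {z. {x, z} \<in> M} + card {z. {y, z} \<in> M}"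
    unfolding X_def by (intro card_Un_le[THEN order_trans] add_mono card_Un_le order_refl)
  then have cX: "real (card X) \<le> \<alpha> * real n" using deg xyn by (simp add: M_def)
  have "real (card (clash n M)) \<le> \<epsilon> * real n ^ 2"
    using card_clash[of M n] assms(10) turan_edges_subset[of n p] unfolding M_def
    by (meson Diff_subset of_nat_mono order_trans)
  then have "\<alpha> ^ card VF / 2 * real n ^ card U \<le> real (card VF ^ card VF) *
     real (card {z \<in> copies VF EF n E. snd z \<inter> (E - turan_edges n p) = {{x, y}}})"
  proof (intro extended_embeddings[where R = "clash n M" and g = g and E = E and \<epsilon> = \<epsilon>
        and W = "\<lambda>w. {z. z < n \<and> p z = \<sigma> (c w)} - X"] U(1) \<alpha> finite_clash)
    show "finite {z \<in> copies VF EF n E. snd z \<inter> (E - turan_edges n p) = {{x, y}}}"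
      using finite_copies[OF F E] by simp
    show "g ` (VF - U) \<subseteq> {..<n}" using xyn by (auto simp: g_def)
    show "inj_on g (VF - U)" using xyn uv by (auto simp: U g_def inj_on_def)
    show "{z. z < n \<and> p z = \<sigma> (c w)} - X \<subseteq> {..<n} - g ` (VF - U) \<and>
          \<alpha> * real n \<le> real (card ({z. z < n \<and> p z = \<sigma> (c w)} - X))" if "w \<in> U" for w
    proof
      have "g ` (VF - U) = {x, y}" using uv by (auto simp: U g_def)
      then show "{z. z < n \<and> p z = \<sigma> (c w)} - X \<subseteq> {..<n} - g ` (VF - U)" by (auto simp: X_def)
      have "card {z. z < n \<and> p z = \<sigma> (c w)} - card X \<le> card ({z. z < n \<and> p z = \<sigma> (c w)} - X)"
        using finN by (intro diff_card_le_card_Diff) (auto simp: X_def)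
      then show "\<alpha> * real n \<le> real (card ({z. z < n \<and> p z = \<sigma> (c w)} - X))"
        using size[OF \<sigma>r, of w] cX that unfolding part_size_def by (auto simp: U_def)
    qed
    show "(a, a) \<in> clash n M" if "a < n" for a using that by (simp add: clash_def)
    fix \<phi> assume \<phi>: "\<phi> \<in> VF \<rightarrow>\<^sub>E {..<n}" "inj_on \<phi> VF"
      and W: "\<And>w. w \<in> U \<Longrightarrow> \<phi> w \<in> {z. z < n \<and> p z = \<sigma> (c w)} - X"
      and g: "\<And>w. w \<in> VF - U \<Longrightarrow> \<phi> w = g w"
      and R: "\<And>w w'. w \<in> U \<Longrightarrow> w' \<in> U \<Longrightarrow> w \<noteq> w' \<Longrightarrow> (\<phi> w, \<phi> w') \<notin> clash n M"
    have gu: "\<phi> u = x" "\<phi> v = y" using g[of u] g[of v] uv by (auto simp: U g_def)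
    have ends: "{\<phi> a, \<phi> b} \<in> E \<inter> turan_edges n p" if "a \<in> {u, v}" "b \<in> U" "c a \<noteq> c b" for a b
    proof -
      have "p (\<phi> a) = \<sigma> (c a)" "\<phi> a < n" using that(1) gu pxy same_colour xyn by (auto simp: \<sigma>_def)
      then have "{\<phi> a, \<phi> b} \<in> turan_edges n p" using W[OF that(2)] \<sigma>inj[OF that(3)] by (simp add: turan_edges_iff)
      moreover have "{\<phi> a, \<phi> b} \<notin> M" using W[OF that(2)] that(1) gu by (auto simp: X_def)
      ultimately show ?thesis by (simp add: M_def)
    qed
    have good: "\<phi> ` e \<in> E \<inter> turan_edges n p" if e: "e \<in> EF" and euv: "e \<noteq> {u, v}" for e
    proof -
      obtain a b where ab: "e = {a, b}" "a \<noteq> b" "a \<in> VF" "b \<in> VF" using edge_pairE[OF e] by metis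
      have cab: "c a \<noteq> c b" using proper e ab euv by auto
      have "\<not> (a \<in> {u, v} \<and> b \<in> {u, v})" using euv ab by auto
      then consider "a \<in> {u, v}" "b \<in> U" | "b \<in> {u, v}" "a \<in> U" | "a \<in> U" "b \<in> U" using ab by (auto simp: U_def)
      then show ?thesis
      proof cases
        case 1 then show ?thesis using ends[of a b] cab ab by simp
      next
        case 2 then show ?thesis using ends[of b a] cab ab by (simp add: insert_commute)
      next
        case 3
        then have "{\<phi> a, \<phi> b} \<in> turan_edges n p" using W[of a] W[of b] \<sigma>inj[OF cab] by (simp add: turan_edges_iff)
        moreover have "{\<phi> a, \<phi> b} \<notin> M"
          using R[of a b] 3 ab W[of a] W[of b] by (simp add: clash_def)
        ultimately show ?thesis using ab by (simp add: M_def)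
      qed
    qed
    have im: "\<phi> ` {u, v} = {x, y}" using gu by simp
    have edges: "\<forall>e\<in>EF. \<phi> ` e \<in> E"
    proof
      fix e assume "e \<in> EF"
      then show "\<phi> ` e \<in> E" using good[of e] im xy by (cases "e = {u, v}") auto
    qed
    have "\<phi> \<in> embs VF EF n E" using \<phi> edges by (simp add: embs_def)
    then have "copy_of VF EF \<phi> \<in> copies VF EF n E" using copies_eq_image_embs[OF F E] by blast
    moreover have "snd (copy_of VF EF \<phi>) \<inter> (E - turan_edges n p) = {{x, y}}"
    proof (intro set_eqI iffI)
      fix b assume b: "b \<in> snd (copy_of VF EF \<phi>) \<inter> (E - turan_edges n p)"
      then obtain e where e: "e \<in> EF" "b = \<phi> ` e" by (auto simp: copy_of_def)
      then have "e = {u, v}" using good[of e] b by auto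
      then show "b \<in> {{x, y}}" using e im by simp
    next
      fix b assume "b \<in> {{x, y}}"
      then have "b = \<phi> ` {u, v}" using im by simp
      then show "b \<in> snd (copy_of VF EF \<phi>) \<inter> (E - turan_edges n p)"
        using xy uv(2) \<open>b \<in> {{x, y}}\<close> unfolding copy_of_def by (auto simp del: image_insert)
    qed
    ultimately show "(\<forall>e\<in>EF. \<phi> ` e \<in> E) \<and> copy_of VF EF \<phi> \<in> {z \<in> copies VF EF n E. snd z \<inter> (E - turan_edges n p) = {{x, y}}}"
      using edges by simp
  qed
  then show ?thesis by (simp add: U)
qed

end

section \<open>Degrees and edges at given vertices\<close>

lemma finite_nbrs: "E \<subseteq> all_edges n \<Longrightarrow> finite {z. {x, z} \<in> E}"
  by (rule finite_subset[of _ "{..<n}"]) (auto dest!: subsetD simp: all_edges_iff)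

lemma card_nbrs_image: "card ((\<lambda>z. {x, z}) ` {z. {x, z} \<in> E}) = card {z. {x, z} \<in> E}"
  by (intro card_image inj_onI) (auto simp: doubleton_eq_iff)

lemma card_nbrs_le:
  assumes "E \<subseteq> all_edges n" shows "card {z. {x, z} \<in> E} \<le> card E"
proof -
  have "finite E" using assms finite_all_edges finite_subset by blast
  then have "card ((\<lambda>z. {x, z}) ` {z. {x, z} \<in> E}) \<le> card E" by (intro card_mono) auto
  then show ?thesis by (simp add: card_nbrs_image)
qed

lemma card_edges_meeting:
  assumes E: "E \<subseteq> all_edges n" and L: "finite L" and d: "\<And>x. x \<in> L \<Longrightarrow> real (card {z. {x, z} \<in> E}) \<le> d"
  shows "real (card {b \<in> E. b \<inter> L \<noteq> {}}) \<le> real (card L) * d"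
proof -
  have "{b \<in> E. b \<inter> L \<noteq> {}} \<subseteq> (\<Union>x\<in>L. (\<lambda>z. {x, z}) ` {z. {x, z} \<in> E})"
  proof
    fix b assume b: "b \<in> {b \<in> E. b \<inter> L \<noteq> {}}"
    then have "b \<in> all_edges n" using E by auto
    then obtain y z where yz: "b = {y, z}" by (auto elim: all_edges_pairE)
    then have "y \<in> L \<or> z \<in> L" using b by auto
    then show "b \<in> (\<Union>x\<in>L. (\<lambda>z. {x, z}) ` {z. {x, z} \<in> E})"
    proof
      assume "y \<in> L" then show ?thesis using b yz by auto
    next
      assume "z \<in> L" moreover have "b = {z, y}" using yz by auto
      ultimately show ?thesis using b by auto
    qed
  qed
  then have "card {b \<in> E. b \<inter> L \<noteq> {}} \<le> card (\<Union>x\<in>L. (\<lambda>z. {x, z}) ` {z. {x, z} \<in> E})"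
    using L finite_nbrs[OF E] by (intro card_mono) auto
  also have "\<dots> \<le> (\<Sum>x\<in>L. card ((\<lambda>z. {x, z}) ` {z. {x, z} \<in> E}))" using L by (rule card_UN_le)
  also have "\<dots> = (\<Sum>x\<in>L. card {z. {x, z} \<in> E})" by (simp add: card_nbrs_image)
  finally have "real (card {b \<in> E. b \<inter> L \<noteq> {}}) \<le> (\<Sum>x\<in>L. real (card {z. {x, z} \<in> E}))"
    by (simp flip: of_nat_sum)
  also have "\<dots> \<le> real (card L) * d" by (rule sum_bounded_above) (rule d)
  finally show ?thesis .
qed

text \<open>Moving x to part i replaces the bad edges at x by its edges to part i. In a partition
  with fewest bad edges, a vertex of linear bad degree therefore has linear degree into every part,
  which is what \<open>vertex_copies\<close> requires.\<close>

lemma min_cut_degree: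
  assumes E: "E \<subseteq> all_edges n" and x: "x < n"
    and le: "card (E - turan_edges n p) \<le> card (E - turan_edges n (p(x := i)))"
  shows "card {z. {x, z} \<in> E - turan_edges n p} \<le> card {z. z < n \<and> p z = i \<and> {x, z} \<in> E}"
proof -
  let ?B = "E - turan_edges n p" and ?B' = "E - turan_edges n (p(x := i))"
  let ?X = "(\<lambda>z. {x, z}) ` {z. {x, z} \<in> ?B}" and ?I = "{z. z < n \<and> p z = i \<and> {x, z} \<in> E}"
  have finB: "finite ?B" using E finite_all_edges finite_subset by blast
  have "?B' \<subseteq> (?B - ?X) \<union> (\<lambda>z. {x, z}) ` ?I"
  proof
    fix e assume e: "e \<in> ?B'"
    have "e \<in> all_edges n" using e E by auto
    then obtain a b where ab: "e = {a, b}" "a < n" "b < n" "a \<noteq> b" by (auto elim: all_edges_pairE)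
    have eq: "(p(x := i)) a = (p(x := i)) b" using e ab by (auto simp: turan_edges_iff)
    consider "a = x" | "b = x" | "a \<noteq> x" "b \<noteq> x" by blast
    then show "e \<in> (?B - ?X) \<union> (\<lambda>z. {x, z}) ` ?I"
    proof cases
      case 1 then show ?thesis using ab eq e by auto
    next
      case 2
      then have "e = {x, a}" using ab by auto
      then show ?thesis using 2 ab eq e by auto
    next
      case 3
      then have "x \<notin> e" "p a = p b" using eq ab by auto
      then have "e \<in> ?B" "e \<notin> ?X" using e unfolding ab(1) by (simp add: turan_edges_iff, blast)
      then show ?thesis by blast
    qed
  qed
  then have "card ?B' \<le> card ((?B - ?X) \<union> (\<lambda>z. {x, z}) ` ?I)" using finB by (intro card_mono) auto
  also have "\<dots> \<le> card (?B - ?X) + card ((\<lambda>z. {x, z}) ` ?I)" by (rule card_Un_le)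
  also have "\<dots> \<le> card (?B - ?X) + card ?I" by (intro add_left_mono card_image_le) auto
  finally have 1: "card ?B' \<le> card (?B - ?X) + card ?I" .
  have "card (?B - ?X) = card ?B - card ?X" using finB finite_subset[OF _ finB, of ?X]
    by (intro card_Diff_subset) auto
  moreover have "card ?X \<le> card ?B" using finB by (intro card_mono) auto
  ultimately show ?thesis using 1 le card_nbrs_image[of x ?B] by linarith
qed

context colour_critical
begin

text \<open>Under \<open>c(u := r)\<close> both ends of every edge of F have different colours, so
  an injective map counted on the left is an embedding of F. The first term bounds the maps that
  identify two vertices.\<close>

lemma card_part_homs_le_copies:
  assumes n: "n > 0" and E: "E \<subseteq> all_edges n"
  shows "real (card (part_homs VF (c(u := r)) E (Suc r) {..<n})) \<le>
    real (card VF) ^ 2 / real n * real n ^ card VF + real (card VF ^ card VF) * real (num_copies VF EF n E)"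
proof -
  define I where "I = {\<phi> \<in> VF \<rightarrow>\<^sub>E {..<n}. \<forall>v\<in>VF. \<forall>w\<in>VF. v \<noteq> w \<longrightarrow> (\<phi> v, \<phi> w) \<notin> Id_on {..<n}}"
  define P where "P = part_homs VF (c(u := r)) E (Suc r) {..<n}"
  have finP: "finite (VF \<rightarrow>\<^sub>E {..<n})" using finite_VF by (intro finite_PiE) auto
  have I_large: "(1 ^ card VF - real (card VF) ^ 2 * (1 / real n)) * real n ^ card VF \<le> real (card I)"
  proof -
    have "finite (Id_on {..<n})" by (rule finite_subset[of _ "{..<n} \<times> {..<n}"]) auto
    moreover have "Id_on {..<n} = (\<lambda>a. (a, a)) ` {..<n}" by auto
    then have "card (Id_on {..<n}) \<le> n" using card_image_le[of "{..<n}" "\<lambda>a. (a, a)"] by simp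
    then have "real (card (Id_on {..<n})) \<le> 1 / real n * real n ^ 2" using n by (simp add: power2_eq_square)
    ultimately show ?thesis unfolding I_def using finite_VF by (intro many_avoiding) auto
  qed
  have "P \<subseteq> ((VF \<rightarrow>\<^sub>E {..<n}) - I) \<union> embs VF EF n E"
  proof
    fix \<phi> assume \<phi>: "\<phi> \<in> P"
    have all: "{w \<in> VF. (c(u := r)) w < Suc r} = VF" using col by (auto intro: less_SucI)
    have \<phi>1: "\<phi> \<in> VF \<rightarrow>\<^sub>E {..<n}" using \<phi> unfolding P_def part_homs_def all by simp
    have \<phi>2: "{\<phi> a, \<phi> b} \<in> E" if "a \<in> VF" "b \<in> VF" "(c(u := r)) a \<noteq> (c(u := r)) b" for a b
      using \<phi> that all unfolding P_def part_homs_def by blast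
    show "\<phi> \<in> ((VF \<rightarrow>\<^sub>E {..<n}) - I) \<union> embs VF EF n E"
    proof (cases "\<phi> \<in> I")
      case True
      have "inj_on \<phi> VF"
      proof (rule inj_onI, rule ccontr)
        fix a b assume ab: "a \<in> VF" "b \<in> VF" "\<phi> a = \<phi> b" "a \<noteq> b"
        have "(\<phi> a, \<phi> b) \<in> Id_on {..<n}" using PiE_mem[OF \<phi>1, of b] ab by (simp add: Id_on_iff)
        moreover have "\<forall>v\<in>VF. \<forall>w\<in>VF. v \<noteq> w \<longrightarrow> (\<phi> v, \<phi> w) \<notin> Id_on {..<n}"
          using True by (simp add: I_def)
        ultimately show False using ab(1,2,4) by metis
      qed
      moreover have "\<phi> ` e \<in> E" if e: "e \<in> EF" for e
      proof -
        obtain a b where ab: "e = {a, b}" "a \<noteq> b" "a \<in> VF" "b \<in> VF" using edge_pairE[OF e] by metis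
        have "(c(u := r)) a \<noteq> (c(u := r)) b"
        proof (cases "a = u \<or> b = u")
          case True
          then show ?thesis using col[OF ab(3)] col[OF ab(4)] ab(2) by auto
        next
          case False
          then have "{a, b} \<noteq> {u, v}" by blast
          then show ?thesis using proper[of a b] ab e False by simp
        qed
        then show ?thesis using \<phi>2 ab by simp
      qed
      ultimately show ?thesis using \<phi>1 by (simp add: embs_def)
    qed (use \<phi>1 in simp)
  qed
  then have "card P \<le> card (((VF \<rightarrow>\<^sub>E {..<n}) - I) \<union> embs VF EF n E)"
    using finP finite_embs[OF finite_VF] by (intro card_mono) auto
  also have "\<dots> \<le> card ((VF \<rightarrow>\<^sub>E {..<n}) - I) + card (embs VF EF n E)" by (rule card_Un_le)
  also have "card ((VF \<rightarrow>\<^sub>E {..<n}) - I) = n ^ card VF - card I"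
  proof -
    have "I \<subseteq> VF \<rightarrow>\<^sub>E {..<n}" by (auto simp: I_def)
    then show ?thesis using finP finite_VF finite_subset[of I] by (subst card_Diff_subset) (auto simp: card_PiE)
  qed
  finally have "card P \<le> n ^ card VF - card I + card (embs VF EF n E)" .
  moreover have "card I \<le> n ^ card VF"
    using card_mono[OF finP, of I] finite_VF by (auto simp: I_def card_PiE)
  ultimately have "card P + card I \<le> n ^ card VF + card (embs VF EF n E)" by linarith
  then have "real (card P + card I) \<le> real (n ^ card VF + card (embs VF EF n E))" by (simp only: of_nat_le_iff)
  moreover have "real (card (embs VF EF n E)) \<le> real (card VF ^ card VF) * real (num_copies VF EF n E)"
    using card_embs_le_card_copies[OF finite_VF order_refl, of EF n E] copies_eq_image_embs[OF F E]
    unfolding num_copies_def by (metis of_nat_le_iff of_nat_mult)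
  ultimately show ?thesis using I_large unfolding P_def by (simp add: algebra_simps)
qed

text \<open>For q at most n the bound on copies is O(n^(f-1)), hence below any fixed multiple of
  n^f, so \<open>stability\<close> applies. Its inequality bounds bad edges by the surplus of cross
  pairs over edges, and this surplus is small because a partition into r parts has at most
  \<open>turan_number r n\<close> cross edges, no more than \<open>card E\<close>.\<close>

lemma close_partition:
  fixes \<gamma> :: real
  assumes "\<gamma> > 0"
  shows "\<exists>n0. \<forall>n q E. n > n0 \<and> q \<le> n \<and> E \<subseteq> all_edges n \<and> turan_number r n \<le> card E \<and>
    num_copies VF EF n E \<le> 8 ^ card VF * q * n ^ (card VF - 2) \<longrightarrow>
    (\<exists>p. (\<forall>x<n. p x < r) \<and> real (card (E - turan_edges n p)) \<le> \<gamma> * real n ^ 2)"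
proof -
  \<comment> \<open>The slack of \<open>stability\<close> costs \<gamma>2/2, and reassigning the
    exceptional vertices costs \<gamma>2 twice: once for the bad edges and once for the cross edges.
    The total is below 3 \<gamma>2.\<close>
  define \<gamma>2 where "\<gamma>2 = \<gamma> / 3"
  define f where "f = card VF"
  have "\<gamma>2 > 0" using assms by (simp add: \<gamma>2_def)
  from stability[OF finite_VF this, of "c(u := r)" r] obtain \<delta> where \<delta>: "\<delta> > 0"
    and stab: "\<forall>n X E. n > 0 \<and> X \<subseteq> {..<n} \<and>
     real (card (part_homs VF (c(u := r)) E (Suc r) X)) < \<delta> * real n ^ card {v \<in> VF. (c(u := r)) v < Suc r} \<longrightarrow>
     (\<exists>p. real (card {x \<in> X. p x \<ge> r}) \<le> \<gamma>2 * real n \<and>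
        real (card (arcs E X X) + card (mono_arcs E p X)) \<le> real (card (cross_pairs p X)) + \<gamma>2 * real n ^ 2)"
    by (elim exE conjE)
  have all: "{w \<in> VF. (c(u := r)) w < Suc r} = VF" using col by (auto intro: less_SucI)
  \<comment> \<open>The first summand comes from the non-injective maps, the second from f^f
    embeddings for each of at most 8^f n^(f-1) copies.\<close>
  define K where "K = real f ^ 2 + real (f ^ f) * 8 ^ f"
  define n0 where "n0 = nat \<lceil>K / \<delta>\<rceil>"
  show ?thesis
  proof (intro exI[of _ n0] allI impI, elim conjE)
    fix n q E assume n: "n > n0" and q: "q \<le> n" and E: "E \<subseteq> all_edges n" and eE: "turan_number r n \<le> card E"
      and few: "num_copies VF EF n E \<le> 8 ^ card VF * q * n ^ (card VF - 2)"
    have n0: "n > 0" using n by simp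
    have "K / \<delta> < real n" using n unfolding n0_def by linarith
    then have Kn: "K / real n < \<delta>" using \<delta> n0 by (simp add: field_simps)
    have pow: "real n * real n ^ (f - 2) = real n ^ f / real n"
    proof -
      have "f = Suc (Suc (f - 2))" using card_VF by (simp add: f_def)
      then have "real n ^ f = real n * (real n * real n ^ (f - 2))" by (metis power_Suc)
      then show ?thesis using n0 by simp
    qed
    have "real (num_copies VF EF n E) \<le> real (8 ^ f * q * n ^ (f - 2))"
      using few unfolding f_def by (simp only: of_nat_le_iff)
    also have "\<dots> = 8 ^ f * (real q * real n ^ (f - 2))" by simp
    also have "\<dots> \<le> 8 ^ f * (real n * real n ^ (f - 2))"
      using q by (intro mult_left_mono mult_right_mono) auto
    finally have nc: "real (num_copies VF EF n E) \<le> 8 ^ f * (real n ^ f / real n)" by (simp only: pow)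
    have "real (card (part_homs VF (c(u := r)) E (Suc r) {..<n})) \<le>
       real f ^ 2 / real n * real n ^ f + real (f ^ f) * real (num_copies VF EF n E)"
      using card_part_homs_le_copies[OF n0 E] by (simp add: f_def)
    also have "\<dots> \<le> real f ^ 2 / real n * real n ^ f + real (f ^ f) * (8 ^ f * (real n ^ f / real n))"
      using nc by (intro add_left_mono mult_left_mono) auto
    also have "\<dots> = K / real n * real n ^ f" by (simp add: K_def add_divide_distrib distrib_right)
    also have "\<dots> < \<delta> * real n ^ f" using Kn n0 by (intro mult_strict_right_mono) auto
    finally have "\<exists>p. real (card {x \<in> {..<n}. p x \<ge> r}) \<le> \<gamma>2 * real n \<and>
        real (card (arcs E {..<n} {..<n}) + card (mono_arcs E p {..<n})) \<le> real (card (cross_pairs p {..<n})) + \<gamma>2 * real n ^ 2"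
      using stab n0 unfolding all f_def by blast
    then obtain p where J: "real (card {x \<in> {..<n}. p x \<ge> r}) \<le> \<gamma>2 * real n"
      and ineq: "2 * real (card E) + 2 * real (card (E - turan_edges n p)) \<le> 2 * real (card (turan_edges n p)) + \<gamma>2 * real n ^ 2"
      using card_arcs[OF E] card_mono_arcs[OF E] card_cross_pairs by auto
    \<comment> \<open>Exceptional vertices are put into part 0. Only edges in \<open>S\<close>,
      those meeting an exceptional vertex, can change between bad and cross.\<close>
    define p' where "p' = (\<lambda>x. if p x < r then p x else 0)"
    define S where "S = {b \<in> all_edges n. b \<inter> {x \<in> {..<n}. p x \<ge> r} \<noteq> {}}"
    have p': "\<forall>x<n. p' x < r" using r by (auto simp: p'_def)
    have finS: "finite S" using finite_all_edges by (simp add: S_def)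
    have finK: "finite (turan_edges n q)" for q using turan_edges_subset finite_all_edges finite_subset by blast
    have "real (card S) \<le> real (card {x \<in> {..<n}. p x \<ge> r}) * real n"
      unfolding S_def
    proof (intro card_edges_meeting[of _ n])
      fix x
      have "card {z. {x, z} \<in> all_edges n} \<le> card {..<n}" by (intro card_mono) (auto simp: all_edges_iff)
      then show "real (card {z. {x, z} \<in> all_edges n}) \<le> real n" by simp
    qed auto
    also have "\<dots> \<le> \<gamma>2 * real n * real n" using J by (intro mult_right_mono) auto
    finally have S: "real (card S) \<le> \<gamma>2 * real n ^ 2" by (simp add: power2_eq_square)
    have same: "e \<in> turan_edges n p \<longleftrightarrow> e \<in> turan_edges n p'" if e: "e \<in> all_edges n - S" for e
    proof -
      obtain a b where ab: "e = {a, b}" "a < n" "b < n" using e by (auto elim: all_edges_pairE)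
      then have "p a < r" "p b < r" using e by (auto simp: S_def)
      then show ?thesis using ab by (simp add: turan_edges_iff p'_def)
    qed
    have "E - turan_edges n p' \<subseteq> (E - turan_edges n p) \<union> S" using same E by blast
    then have "card (E - turan_edges n p') \<le> card ((E - turan_edges n p) \<union> S)"
      using finS E finite_all_edges finite_subset by (intro card_mono) blast+
    also have "\<dots> \<le> card (E - turan_edges n p) + card S" by (rule card_Un_le)
    finally have 1: "card (E - turan_edges n p') \<le> card (E - turan_edges n p) + card S" .
    have "turan_edges n p \<subseteq> turan_edges n p' \<union> S" using same turan_edges_subset by blast
    then have "card (turan_edges n p) \<le> card (turan_edges n p' \<union> S)"
      using finS finK by (intro card_mono) auto
    also have "\<dots> \<le> card (turan_edges n p') + card S" by (rule card_Un_le)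
    finally have "card (turan_edges n p) \<le> card E + card S"
      using card_turan_edges_le[OF _ p'] r eE by simp
    then have 2: "real (card (turan_edges n p)) \<le> real (card E) + real (card S)" by linarith
    have "\<gamma>2 * real n ^ 2 \<ge> 0" using \<open>\<gamma>2 > 0\<close> by simp
    then have "real (card (E - turan_edges n p')) \<le> 3 * (\<gamma>2 * real n ^ 2)"
      using 1 2 S ineq by linarith
    then show "\<exists>p. (\<forall>x<n. p x < r) \<and> real (card (E - turan_edges n p)) \<le> \<gamma> * real n ^ 2"
      using p' by (intro exI[of _ p']) (simp add: \<gamma>2_def)
  qed
qed

end

subsection \<open>Structure of graphs with few copies\<close>

context colour_critical
begin

text \<open>The density given by \<open>bad_edge_copies\<close> with \<alpha> = 1/(4r): parts of at
  least n/(2r) vertices have the required size 2 \<alpha> n.\<close>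

definition kappa :: real where
  "kappa = (1 / (4 * real r)) ^ card VF / 2 / real (card VF ^ card VF)"

lemma kappa_pos: "kappa > 0"
  using r card_VF by (simp add: kappa_def)

text \<open>The edges of \<open>turan_edges n p - E\<close> are missing, those of \<open>E - turan_edges n p\<close> bad. Since the bad
  degrees are at most a quarter of the threshold \<open>\<mu> n\<close> for missing degrees and there are no more
  missing than bad edges, at most half of the bad edges meet a vertex above the threshold.\<close>

lemma card_bad_edges_le:
  fixes \<mu> k :: real
  assumes E: "E \<subseteq> all_edges n" and n: "n > 0" and M: "card (turan_edges n p - E) \<le> card (E - turan_edges n p)"
    and \<mu>: "\<mu> > 0"
    and deg: "\<And>x. x < n \<Longrightarrow> real (card {z. {x, z} \<in> E - turan_edges n p}) \<le> \<mu> / 4 * real n"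
    and k: "k > 0"
    and typical: "\<And>x y. {x, y} \<in> E - turan_edges n p \<Longrightarrow>
      real (card {z. {x, z} \<in> turan_edges n p - E}) < \<mu> * real n \<Longrightarrow>
      real (card {z. {y, z} \<in> turan_edges n p - E}) < \<mu> * real n \<Longrightarrow>
      k \<le> real (card {z \<in> copies VF EF n E. snd z \<inter> (E - turan_edges n p) = {{x, y}}})"
  shows "real (card (E - turan_edges n p)) * k \<le> 2 * real (num_copies VF EF n E)"
proof -
  define B M where "B = E - turan_edges n p" and "M = turan_edges n p - E"
  define L where "L = {x. x < n \<and> \<mu> * real n \<le> real (card {z. {x, z} \<in> M})}"
  define BL where "BL = {b \<in> B. b \<inter> L \<noteq> {}}"
  have B: "B \<subseteq> all_edges n" using E by (auto simp: B_def)
  have Ma: "M \<subseteq> all_edges n" using turan_edges_subset by (auto simp: M_def)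
  have finB: "finite B" using B finite_all_edges finite_subset by blast
  have finL: "finite L" by (simp add: L_def)
  \<comment> \<open>The missing degrees over \<open>L\<close> sum to at most 2 |M|. So
    \<open>L\<close> has at most 2 |M| / (\<mu> n) vertices, each on at most \<mu> n / 4 bad
    edges.\<close>
  have "real (card L) * (\<mu> * real n) \<le> (\<Sum>x\<in>L. real (card {z. {x, z} \<in> M}))"
    by (rule sum_bounded_below) (simp add: L_def)
  also have "\<dots> \<le> (\<Sum>x<n. real (card {z. {x, z} \<in> M}))"
    by (intro sum_mono2) (auto simp: L_def)
  also have "\<dots> = real (card (arcs M {..<n} {..<n}))"
  proof -
    have "{z. {x, z} \<in> M} = {z \<in> {..<n}. {x, z} \<in> M}" for x using Ma all_edges_iff by blast
    then show ?thesis by (simp add: card_arcs_sum)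
  qed
  also have "\<dots> = 2 * real (card M)" using card_arcs[OF Ma] by simp
  finally have L: "real (card L) * (\<mu> * real n) \<le> 2 * real (card M)" .
  have "real (card BL) \<le> real (card L) * (\<mu> / 4 * real n)"
    unfolding BL_def using deg by (intro card_edges_meeting[OF B finL]) (auto simp: L_def B_def)
  also have "\<dots> = real (card L) * (\<mu> * real n) / 4" by simp
  also have "\<dots> \<le> real (card B) / 2" using L of_nat_mono[OF M, where 'a = real] unfolding B_def M_def by linarith
  finally have BL: "real (card BL) \<le> real (card B) / 2" .
  have "card (B - BL) = card B - card BL" "card BL \<le> card B"
    using finB by (auto simp: BL_def card_Diff_subset intro: card_mono)
  then have BG: "real (card B) / 2 \<le> real (card (B - BL))" using BL by linarith
  define Z where "Z = (\<lambda>b. {z \<in> copies VF EF n E. snd z \<inter> B = {b}})"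
  have Zk: "k \<le> real (card (Z b))" if b: "b \<in> B - BL" for b
  proof -
    have "b \<in> all_edges n" using b B by blast
    then obtain x y where xy: "b = {x, y}" "x < n" "y < n" by (auto elim: all_edges_pairE)
    then have "x \<notin> L" "y \<notin> L" using b by (auto simp: BL_def)
    then show ?thesis using typical[of x y] b xy by (auto simp: L_def B_def M_def Z_def)
  qed
  have "real (card B) / 2 * k \<le> real (card (B - BL)) * k" using BG k by (intro mult_right_mono) auto
  also have "\<dots> \<le> (\<Sum>b\<in>B - BL. real (card (Z b)))" using Zk by (rule sum_bounded_below)
  also have "\<dots> = real (\<Sum>b\<in>B - BL. card (Z b))" by simp
  \<comment> \<open>Disjoint, since a copy in \<open>Z b\<close> has b as its only bad edge.\<close>
  also have "(\<Sum>b\<in>B - BL. card (Z b)) = card (\<Union>b\<in>B - BL. Z b)"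
    using finB finite_copies[OF F E] by (intro card_UN_disjoint[symmetric]) (auto simp: Z_def)
  also have "real \<dots> \<le> real (num_copies VF EF n E)"
    unfolding num_copies_def using finite_copies[OF F E] by (intro of_nat_mono card_mono) (auto simp: Z_def)
  finally show ?thesis by (simp add: B_def)
qed

text \<open>The number of bad edges is bounded twice. The bound \<gamma> n^2 is enough to bound bad
  degrees and to embed around typical bad edges, which improves it to O(q), at most \<eta>' n. Then
  no vertex can miss more than \<mu> n cross edges, so every bad edge is typical.\<close>

lemma near_turan_structure:
  fixes \<eta> :: real
  assumes "\<eta> > 0"
  shows "\<exists>c1>0. \<exists>n0. \<forall>n q E. n > n0 \<and> real q < c1 * real n \<and> E \<subseteq> all_edges n \<and>
    card E = turan_number r n + q \<and> num_copies VF EF n E \<le> 8 ^ card VF * q * n ^ (card VF - 2) \<longrightarrow>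
    (\<exists>p. (\<forall>x<n. p x < r) \<and> (\<forall>i<r. real n / (2 * real r) \<le> real (part_size n p i)) \<and>
      real (card (E - turan_edges n p)) \<le> \<eta> * real n \<and>
      (\<forall>b\<in>E - turan_edges n p. kappa * real n ^ (card VF - 2) \<le> real (card {z \<in> copies VF EF n E. b \<in> snd z})))"
proof -
  define f where "f = card VF"
  \<comment> \<open>Parts have at least 2 \<alpha> n vertices. Missing degrees up to \<mu> n at both
    ends leave room for the 2 in \<open>bad_edge_copies\<close>; \<beta> is the quarter of \<mu>
    asked for by \<open>card_bad_edges_le\<close>. \<epsilon> makes the union bound lose exactly
    half at density \<beta>, and \<gamma> is small enough both for \<epsilon> and for
    \<open>part_size_large\<close>.\<close>
  define \<alpha> where "\<alpha> = 1 / (4 * real r)"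
  define \<mu> where "\<mu> = \<alpha> / 4"
  define \<beta> where "\<beta> = \<mu> / 4"
  define \<epsilon> where "\<epsilon> = \<beta> ^ f / (2 * real f ^ 2)"
  define \<gamma> where "\<gamma> = min (\<epsilon> / 4) (1 / (16 * real r ^ 2))"
  define \<eta>' where "\<eta>' = min \<eta> \<mu>"
  \<comment> \<open>The first bound contradicts a vertex of bad degree above \<beta> n, the second
    turns |B| kappa <= 2 8^f q into |B| <= \<eta>' n, and 1 ensures q <= n.\<close>
  define c1 where "c1 = min 1 (min (\<beta> ^ f / (2 * real (f ^ f) * 8 ^ f)) (\<eta>' * kappa / (2 * 8 ^ f)))"
  have f3: "f \<ge> 3" using card_VF by (simp add: f_def)
  have ff: "real (f ^ f) > 0" using f3 by simp
  have \<alpha>: "0 < \<alpha>" "\<alpha> \<le> 1" using r by (auto simp: \<alpha>_def)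
  have \<mu>: "\<mu> > 0" "\<mu> \<le> \<alpha>" using \<alpha> by (auto simp: \<mu>_def)
  have \<beta>: "0 < \<beta>" "\<beta> \<le> \<alpha>" "\<beta> \<le> 1" using \<alpha> \<mu> by (auto simp: \<beta>_def)
  have \<epsilon>: "\<epsilon> > 0" "real f ^ 2 * \<epsilon> = \<beta> ^ f / 2" using \<beta> f3 by (auto simp: \<epsilon>_def)
  have \<epsilon>\<alpha>: "real f ^ 2 * \<epsilon> \<le> \<alpha> ^ f / 2"
    using \<epsilon>(2) power_mono[of \<beta> \<alpha> f] \<beta> by auto
  have \<gamma>: "\<gamma> > 0" "\<gamma> \<le> \<epsilon> / 4" "\<gamma> \<le> 1 / (16 * real r ^ 2)" using \<epsilon> r by (auto simp: \<gamma>_def)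
  have \<eta>': "\<eta>' > 0" "\<eta>' \<le> \<eta>" "\<eta>' \<le> \<mu>" using \<mu> assms by (auto simp: \<eta>'_def)
  have c1: "c1 > 0" "c1 \<le> 1" "c1 \<le> \<beta> ^ f / (2 * real (f ^ f) * 8 ^ f)" "c1 \<le> \<eta>' * kappa / (2 * 8 ^ f)"
    using \<beta> ff \<eta>' kappa_pos by (auto simp: c1_def)
  obtain n1 where n1: "\<forall>n q E. n > n1 \<and> q \<le> n \<and> E \<subseteq> all_edges n \<and> turan_number r n \<le> card E \<and>
    num_copies VF EF n E \<le> 8 ^ card VF * q * n ^ (card VF - 2) \<longrightarrow>
    (\<exists>p. (\<forall>x<n. p x < r) \<and> real (card (E - turan_edges n p)) \<le> \<gamma> * real n ^ 2)"
    using close_partition[OF \<gamma>(1)] by (elim exE)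
  \<comment> \<open>2/\<epsilon> absorbs the n diagonal pairs of \<open>clash\<close>, 4/\<alpha>
    the two endpoints of a bad edge, and 8 r^3 the summand r in
    \<open>part_size_large\<close>.\<close>
  define n0 where "n0 = max n1 (max (nat \<lceil>2 / \<epsilon>\<rceil>) (max (nat \<lceil>4 / \<alpha>\<rceil>) (8 * r ^ 3)))"
  show ?thesis
  proof (intro exI[of _ c1] conjI exI[of _ n0] allI impI c1(1), elim conjE)
    fix n q E assume n: "n > n0" and q: "real q < c1 * real n" and E: "E \<subseteq> all_edges n"
      and cE: "card E = turan_number r n + q"
      and few: "num_copies VF EF n E \<le> 8 ^ card VF * q * n ^ (card VF - 2)"
    have n': "n > n1" "2 / \<epsilon> \<le> real n" "4 / \<alpha> \<le> real n" "n > 8 * r ^ 3" "n > 0"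
      using n unfolding n0_def by (simp_all add: ceiling_le_iff nat_le_iff) linarith+
    have finE: "finite E" using E finite_all_edges finite_subset by blast
    have "c1 * real n \<le> 1 * real n" using c1(2) by (intro mult_right_mono) auto
    then have "q \<le> n" using q by simp
    then obtain p0 where p0: "\<forall>x<n. p0 x < r" "real (card (E - turan_edges n p0)) \<le> \<gamma> * real n ^ 2"
      using n1[rule_format, of n q E] n' E cE few by auto
    \<comment> \<open>The partition from \<open>close_partition\<close> is replaced by one with
      fewest bad edges, for the sake of \<open>min_cut_degree\<close>.\<close>
    obtain p where p: "\<forall>x<n. p x < r" and pmin: "\<And>p'. \<forall>x<n. p' x < r \<Longrightarrow> card (E - turan_edges n p) \<le> card (E - turan_edges n p')"
      using ex_has_least_nat[of "\<lambda>p. \<forall>x<n. p x < r" p0 "\<lambda>p. card (E - turan_edges n p)"] p0(1) by blast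
    define B M where "B = E - turan_edges n p" and "M = turan_edges n p - E"
    have cB: "real (card B) \<le> \<gamma> * real n ^ 2" using pmin[OF p0(1)] p0(2) unfolding B_def by linarith
    have finK: "finite (turan_edges n p)" using turan_edges_subset finite_all_edges finite_subset by blast
    have eqs: "card E = card (E \<inter> turan_edges n p) + card B" "card (turan_edges n p) = card (E \<inter> turan_edges n p) + card M"
    proof -
      show "card E = card (E \<inter> turan_edges n p) + card B"
        unfolding B_def using finE by (subst card_Un_disjoint[symmetric]) (auto intro: arg_cong[where f = card])
      show "card (turan_edges n p) = card (E \<inter> turan_edges n p) + card M"
        unfolding M_def using finK by (subst card_Un_disjoint[symmetric]) (auto intro: arg_cong[where f = card])
    qed
    have tur: "card (turan_edges n p) \<le> turan_number r n" using card_turan_edges_le[OF _ p] r by simp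
    \<comment> \<open>E has at least as many edges as there are cross pairs, so bad edges make up
      for the missing ones. From here on a bound on \<open>B\<close> is also one on
      \<open>M\<close>.\<close>
    have MB: "card M \<le> card B" using eqs cE tur by linarith
    have size: "real n / (2 * real r) \<le> real (part_size n p i)" if "i < r" for i
    proof (rule part_size_large[OF _ p that])
      show "real (turan_number r n) - real (card (turan_edges n p)) \<le> \<gamma> * real n ^ 2"
        using eqs cE cB by linarith
      have "\<gamma> * real n ^ 2 \<le> 1 / (16 * real r ^ 2) * real n ^ 2" using \<gamma> by (intro mult_right_mono) auto
      moreover have "real r \<le> 1 / (8 * real r ^ 2) * real n ^ 2"
      proof -
        have "8 * r ^ 3 \<le> n * n" using n'(4) le_square[of n] by linarith
        then have "real (8 * r ^ 3) \<le> real (n * n)" by (simp only: of_nat_le_iff)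
        then have "8 * (real r * real r ^ 2) \<le> real n ^ 2" by (simp add: power2_eq_square power3_eq_cube)
        then show ?thesis using r by (simp add: field_simps)
      qed
      moreover have "(real n / (2 * real r))\<^sup>2 = 1 / (4 * real r ^ 2) * real n ^ 2"
        by (simp add: power_divide power_mult_distrib)
      ultimately show "real r + 2 * (\<gamma> * real n ^ 2) \<le> (real n / (2 * real r))\<^sup>2" by (simp add: field_simps)
    qed (use r in auto)
    have size2: "2 * \<alpha> * real n \<le> real (part_size n p i)" if "i < r" for i
      using size[OF that] by (simp add: \<alpha>_def)
    have Mn: "real (n + 2 * card M) \<le> \<epsilon> * real n ^ 2"
    proof -
      have "real (card M) \<le> \<gamma> * real n ^ 2" using MB cB by linarith
      also have "\<dots> \<le> \<epsilon> / 4 * real n ^ 2" using \<gamma> by (intro mult_right_mono) auto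
      finally have "2 * real (card M) \<le> \<epsilon> / 2 * real n ^ 2" by simp
      moreover have "real n \<le> \<epsilon> / 2 * real n ^ 2"
      proof -
        have "1 \<le> \<epsilon> / 2 * real n" using n'(2) \<epsilon>(1) by (simp add: field_simps)
        then have "1 * real n \<le> \<epsilon> / 2 * real n * real n" by (intro mult_right_mono) auto
        then show ?thesis by (simp add: power2_eq_square)
      qed
      ultimately show ?thesis by simp
    qed
    have few': "real (num_copies VF EF n E) \<le> 8 ^ f * real q * real n ^ (f - 2)"
    proof -
      have "real (num_copies VF EF n E) \<le> real (8 ^ f * q * n ^ (f - 2))"
        using few unfolding f_def by (simp only: of_nat_le_iff)
      then show ?thesis by simp
    qed
    have deg: "real (card {z. {x, z} \<in> E - turan_edges n p}) \<le> \<mu> / 4 * real n" if x: "x < n" for x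
    proof (rule ccontr)
      assume "\<not> ?thesis"
      then have big: "\<beta> * real n \<le> real (card {z. {x, z} \<in> E - turan_edges n p})" by (simp add: \<beta>_def)
      have "\<beta> * real n \<le> real (card {z. z < n \<and> p z = i \<and> {x, z} \<in> E})" if i: "i < r" for i
      proof -
        have "\<forall>y<n. (p(x := i)) y < r" using p i by auto
        then show ?thesis using min_cut_degree[OF E x pmin] big by (meson of_nat_mono order_trans)
      qed
      then have "\<beta> ^ f / 2 * real n ^ (f - 1) \<le> real (f ^ f) * real (num_copies VF EF n E)"
        unfolding f_def using \<beta> \<epsilon> Mn by (intro vertex_copies[OF E x, where \<epsilon> = \<epsilon> and p = p]) (auto simp: M_def f_def)
      also have "\<dots> \<le> real (f ^ f) * (8 ^ f * real q * real n ^ (f - 2))"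
        using few' by (intro mult_left_mono) auto
      also have "\<dots> < real (f ^ f) * (8 ^ f * (c1 * real n) * real n ^ (f - 2))"
        using q ff n' by (intro mult_strict_left_mono mult_strict_right_mono) auto
      also have "\<dots> = c1 * (real (f ^ f) * 8 ^ f) * real n ^ (f - 1)"
      proof -
        have "f - 1 = Suc (f - 2)" using f3 by simp
        then show ?thesis by simp
      qed
      also have "\<dots> \<le> \<beta> ^ f / 2 * real n ^ (f - 1)"
      proof (intro mult_right_mono)
        have "c1 * (real (f ^ f) * 8 ^ f) \<le> \<beta> ^ f / (2 * real (f ^ f) * 8 ^ f) * (real (f ^ f) * 8 ^ f)"
          using c1(3) by (intro mult_right_mono) auto
        also have "\<dots> = \<beta> ^ f / 2" using ff by simp
        finally show "c1 * (real (f ^ f) * 8 ^ f) \<le> \<beta> ^ f / 2" .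
      qed auto
      finally show False by simp
    qed
    have typical: "kappa * real n ^ (f - 2) \<le> real (card {z \<in> copies VF EF n E. snd z \<inter> B = {{x, y}}})"
      if "{x, y} \<in> B" "real (card {z. {x, z} \<in> M}) \<le> \<mu> * real n" "real (card {z. {y, z} \<in> M}) \<le> \<mu> * real n" for x y
    proof -
      have "2 \<le> \<alpha> / 2 * real n" using n'(3) \<alpha>(1) by (simp add: field_simps)
      then have "real (2 + card {z. {x, z} \<in> M} + card {z. {y, z} \<in> M}) \<le> \<alpha> * real n"
        using that(2,3) by (simp add: \<mu>_def)
      then have "\<alpha> ^ f / 2 * real n ^ (f - 2) \<le> real (f ^ f) * real (card {z \<in> copies VF EF n E. snd z \<inter> B = {{x, y}}})"
        using that(1) size2 \<alpha> \<epsilon> \<epsilon>\<alpha> Mn unfolding f_def B_def M_def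
        by (intro bad_edge_copies[OF E p, where \<epsilon> = \<epsilon>]) auto
      then have "\<alpha> ^ f / 2 * real n ^ (f - 2) / real (f ^ f) \<le> real (card {z \<in> copies VF EF n E. snd z \<inter> B = {{x, y}}})"
        using ff by (simp only: pos_divide_le_eq mult.commute)
      then show ?thesis by (simp add: kappa_def \<alpha>_def f_def)
    qed
    have kn: "kappa * real n ^ (f - 2) > 0" using kappa_pos n' by simp
    have "real (card B) * (kappa * real n ^ (f - 2)) \<le> 2 * real (num_copies VF EF n E)"
      unfolding B_def using MB \<mu> deg kn n' typical
      by (intro card_bad_edges_le[where \<mu> = \<mu>] E) (auto simp: B_def M_def)
    also have "\<dots> \<le> 2 * (8 ^ f * real q * real n ^ (f - 2))" using few' by simp
    finally have "real (card B) * kappa * real n ^ (f - 2) \<le> 2 * 8 ^ f * real q * real n ^ (f - 2)"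
      by (simp add: mult.assoc)
    then have "real (card B) * kappa \<le> 2 * 8 ^ f * real q" using n' by simp
    also have "\<dots> \<le> 2 * 8 ^ f * (c1 * real n)" using q by (intro mult_left_mono) auto
    also have "\<dots> \<le> 2 * 8 ^ f * (\<eta>' * kappa / (2 * 8 ^ f) * real n)"
      using c1(4) by (intro mult_left_mono mult_right_mono) auto
    also have "\<dots> = \<eta>' * real n * kappa" by simp
    finally have B\<eta>: "real (card B) \<le> \<eta>' * real n" using kappa_pos by simp
    also have "\<dots> \<le> \<eta> * real n" using \<eta>' by (intro mult_right_mono) auto
    finally have B\<eta>2: "real (card B) \<le> \<eta> * real n" .
    have \<mu>n: "\<eta>' * real n \<le> \<mu> * real n" using \<eta>' by (intro mult_right_mono) auto
    have md: "real (card {z. {x, z} \<in> M}) \<le> \<mu> * real n" for x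
    proof -
      have "card {z. {x, z} \<in> M} \<le> card M"
        using turan_edges_subset by (intro card_nbrs_le[of _ n]) (auto simp: M_def)
      then show ?thesis using MB B\<eta> \<mu>n by linarith
    qed
    have "kappa * real n ^ (card VF - 2) \<le> real (card {z \<in> copies VF EF n E. b \<in> snd z})" if b: "b \<in> B" for b
    proof -
      have "b \<in> all_edges n" using b E by (auto simp: B_def)
      then obtain x y where xy: "b = {x, y}" by (auto elim: all_edges_pairE)
      have "kappa * real n ^ (f - 2) \<le> real (card {z \<in> copies VF EF n E. snd z \<inter> B = {{x, y}}})"
        using typical md b xy by auto
      also have "\<dots> \<le> real (card {z \<in> copies VF EF n E. b \<in> snd z})"
        using finite_copies[OF F E] xy by (intro of_nat_mono card_mono) auto
      finally show ?thesis by (simp add: f_def)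
    qed
    then show "\<exists>p. (\<forall>x<n. p x < r) \<and> (\<forall>i<r. real n / (2 * real r) \<le> real (part_size n p i)) \<and>
      real (card (E - turan_edges n p)) \<le> \<eta> * real n \<and>
      (\<forall>b\<in>E - turan_edges n p. kappa * real n ^ (card VF - 2) \<le> real (card {z \<in> copies VF EF n E. b \<in> snd z}))"
      using p size B\<eta>2 unfolding B_def by blast
  qed
qed

end

subsection \<open>Minimizers\<close>

lemma all_edges_card: "e \<in> all_edges n \<Longrightarrow> finite e \<and> card e = 2"
  unfolding all_edges_def using finite_subset[of e "{0..<n}"] by simp

lemma finite_counts: "finite {g E | E. E \<subseteq> all_edges n \<and> P E}"
  by (rule finite_subset[of _ "g ` Pow (all_edges n)"]) (auto simp: finite_all_edges)

lemma hF_le: "E \<subseteq> all_edges n \<Longrightarrow> card E = ex n VF EF + q \<Longrightarrow> hF VF EF n q \<le> num_copies VF EF n E"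
  unfolding hF_def by (rule Min_le[OF finite_counts]) auto

text \<open>\<open>Min\<close> of an empty set is unspecified, so a graph with the right number of
  edges must be exhibited before the minimum is known to be attained.\<close>

lemma HF_nonempty:
  assumes "E \<subseteq> all_edges n" "card E = ex n VF EF + q"
  shows "HF VF EF n q \<noteq> {}"
proof -
  let ?S = "{num_copies VF EF n E | E. E \<subseteq> all_edges n \<and> card E = ex n VF EF + q}"
  have "hF VF EF n q \<in> ?S" unfolding hF_def by (rule Min_in[OF finite_counts]) (use assms in auto)
  then show ?thesis by (auto simp: HF_def)
qed

text \<open>The pairs {v, v + r} join vertices of equal residue, and there are n - r of
  them.\<close>

lemma many_non_turan_edges:
  assumes "r > 0" "q + r \<le> n"
  obtains A where "A \<subseteq> all_edges n - turan_edges n (\<lambda>v. v mod r)" "card A = q"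
proof -
  let ?N = "(\<lambda>v. {v, v + r}) ` {..<n - r}"
  have "card ?N = n - r"
    using assms by (subst card_image) (auto simp: inj_on_def doubleton_eq_iff)
  then have "q \<le> card ?N" using assms(2) by linarith
  then obtain A where "A \<subseteq> ?N" "card A = q" by (rule obtain_subset_with_card_n)
  moreover have "?N \<subseteq> all_edges n - turan_edges n (\<lambda>v. v mod r)"
    using assms by (auto simp: all_edges_iff turan_edges_iff)
  ultimately show ?thesis using that by blast
qed

context colour_critical
begin

text \<open>Exchange principle: the copies through b are lost, at least kappa n^(f-2) of them, while
  each gained copy has three vertices in one of at most \<eta> n sets, leaving f - 3 free vertices.
  The gain is at most \<eta> 8^f n^(f-2).\<close>

lemma fewer_copies:
  fixes \<eta> :: real
  assumes E: "E \<subseteq> all_edges n" and E': "E' \<subseteq> all_edges n" and n: "n > 0"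
    and b: "kappa * real n ^ (card VF - 2) \<le> real (card {z \<in> copies VF EF n E. b \<in> snd z})"
    and \<eta>: "\<eta> * 8 ^ card VF < kappa"
    and XX: "finite XX" "\<And>X. X \<in> XX \<Longrightarrow> finite X \<and> card X \<le> 4" "real (card XX) \<le> \<eta> * real n"
    and new: "\<And>z. z \<in> copies VF EF n E' \<Longrightarrow> (z \<in> copies VF EF n E \<and> b \<notin> snd z) \<or> (\<exists>X\<in>XX. card (fst z \<inter> X) \<ge> 3)"
  shows "num_copies VF EF n E' < num_copies VF EF n E"
proof -
  let ?old = "{z \<in> copies VF EF n E. b \<in> snd z}" and ?new = "{z \<in> copies VF EF n E'. \<exists>X\<in>XX. card (fst z \<inter> X) \<ge> 3}"
  have fin: "finite (copies VF EF n E)" "finite (copies VF EF n E')" using finite_copies[OF F] E E' by auto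
  have "copies VF EF n E' \<subseteq> (copies VF EF n E - ?old) \<union> ?new" using new by blast
  then have "num_copies VF EF n E' \<le> card ((copies VF EF n E - ?old) \<union> ?new)"
    unfolding num_copies_def using fin by (intro card_mono) auto
  also have "\<dots> \<le> card (copies VF EF n E - ?old) + card ?new" by (rule card_Un_le)
  also have "card (copies VF EF n E - ?old) = num_copies VF EF n E - card ?old"
    unfolding num_copies_def using fin by (intro card_Diff_subset) auto
  finally have 1: "num_copies VF EF n E' \<le> num_copies VF EF n E - card ?old + card ?new" .
  have 2: "card ?old \<le> num_copies VF EF n E"
    unfolding num_copies_def using fin by (intro card_mono) auto
  have "card ?new \<le> card XX * 8 ^ card VF * n ^ (card VF - 3)"
    by (rule card_copies_hitting[OF F E' n XX(1,2)])
  then have "real (card ?new) \<le> real (card XX * 8 ^ card VF * n ^ (card VF - 3))" by (simp only: of_nat_le_iff)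
  also have "\<dots> = real (card XX) * (8 ^ card VF * real n ^ (card VF - 3))" by simp
  also have "\<dots> \<le> \<eta> * real n * (8 ^ card VF * real n ^ (card VF - 3))"
    using XX(3) by (intro mult_right_mono) auto
  also have "\<dots> = \<eta> * 8 ^ card VF * real n ^ (card VF - 2)"
  proof -
    have "card VF - 2 = Suc (card VF - 3)" using card_VF by simp
    then show ?thesis by simp
  qed
  also have "\<dots> < kappa * real n ^ (card VF - 2)" using \<eta> n by (intro mult_strict_right_mono) auto
  also have "\<dots> \<le> real (card ?old)" by (rule b)
  finally have "card ?new < card ?old" by simp
  then show ?thesis using 1 2 by linarith
qed

text \<open>Every copy contains both ends of an added edge, so f - 2 vertices are free. This
  supplies the upper bound on the number of copies in a minimizer.\<close>

lemma few_copies_turan_plus: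
  assumes n: "n > 0" and p: "\<forall>x<n. p x < r" and A: "A \<subseteq> all_edges n - turan_edges n p"
  shows "num_copies VF EF n (turan_edges n p \<union> A) \<le> 8 ^ card VF * card A * n ^ (card VF - 2)"
proof -
  let ?E = "turan_edges n p \<union> A"
  have E: "?E \<subseteq> all_edges n" using A turan_edges_subset by auto
  have finA: "finite A" using A finite_all_edges finite_subset by blast
  have two: "finite a \<and> card a = 2" if "a \<in> A" for a
    using that A all_edges_card by blast
  have "\<exists>a\<in>A. card (fst z \<inter> a) \<ge> 2" if z: "z \<in> copies VF EF n ?E" for z
  proof -
    obtain a where a: "a \<in> ?E - turan_edges n p" "a \<subseteq> fst z" using copy_has_bad_edge[OF p z] by blast
    then have "a \<in> A" "fst z \<inter> a = a" by auto
    then show ?thesis using two[of a] by (intro bexI[of _ a]) auto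
  qed
  then have "copies VF EF n ?E = {z \<in> copies VF EF n ?E. \<exists>a\<in>A. card (fst z \<inter> a) \<ge> 2}" by blast
  then have "num_copies VF EF n ?E = card {z \<in> copies VF EF n ?E. \<exists>a\<in>A. card (fst z \<inter> a) \<ge> 2}"
    unfolding num_copies_def by simp
  also have "\<dots> \<le> card A * 8 ^ card VF * n ^ (card VF - 2)"
    using two by (intro card_copies_hitting[OF F E n finA]) auto
  finally show ?thesis by (simp add: mult.commute)
qed

text \<open>Exchange a bad edge b for a missing cross edge m. A new copy contains m and, like every
  copy, some bad edge b'. As b' differs from m, their union has at least three vertices; these
  unions form \<open>XX\<close>.\<close>

lemma minimizer_complete:
  fixes \<eta> :: real
  assumes E: "E \<subseteq> all_edges n" and n: "n > 0" and p: "\<forall>x<n. p x < r" and \<eta>: "\<eta> * 8 ^ card VF < kappa"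
    and B: "real (card (E - turan_edges n p)) \<le> \<eta> * real n"
    and bad: "\<And>b. b \<in> E - turan_edges n p \<Longrightarrow>
      kappa * real n ^ (card VF - 2) \<le> real (card {z \<in> copies VF EF n E. b \<in> snd z})"
    and ne: "E - turan_edges n p \<noteq> {}"
    and min: "\<And>E'. E' \<subseteq> all_edges n \<Longrightarrow> card E' = card E \<Longrightarrow> num_copies VF EF n E \<le> num_copies VF EF n E'"
  shows "turan_edges n p \<subseteq> E"
proof (rule ccontr)
  assume "\<not> ?thesis"
  then obtain m where m: "m \<in> turan_edges n p" "m \<notin> E" by blast
  obtain b where b: "b \<in> E" "b \<notin> turan_edges n p" using ne by blast
  have finE: "finite E" using E finite_all_edges finite_subset by blast
  define E' where "E' = insert m (E - {b})"
  define XX where "XX = (\<lambda>b'. m \<union> b') ` (E - turan_edges n p)"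
  have E': "E' \<subseteq> all_edges n" using E m turan_edges_subset by (auto simp: E'_def)
  have "card E' = Suc (card (E - {b}))" unfolding E'_def using finE m by (intro card_insert_disjoint) auto
  then have cE': "card E' = card E" using card_Suc_Diff1[OF finE b(1)] by simp
  note two = all_edges_card[of _ n]
  have m2: "finite m \<and> card m = 2" using two m turan_edges_subset by blast
  have "num_copies VF EF n E' < num_copies VF EF n E"
  proof (rule fewer_copies[OF E E' n bad \<eta>, of b XX])
    show "b \<in> E - turan_edges n p" using b by simp
    show "finite XX" using finE by (simp add: XX_def)
    have "card XX \<le> card (E - turan_edges n p)" unfolding XX_def using finE by (intro card_image_le) auto
    then show "real (card XX) \<le> \<eta> * real n" using B by linarith
    show "finite X \<and> card X \<le> 4" if X: "X \<in> XX" for X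
    proof -
      obtain b' where b': "X = m \<union> b'" "b' \<in> E" using X by (auto simp: XX_def)
      then have "finite b' \<and> card b' = 2" using two E by blast
      then show ?thesis using b' m2 card_Un_le[of m b'] by auto
    qed
    fix z assume z: "z \<in> copies VF EF n E'"
    have zE: "snd z \<subseteq> E'" "\<forall>e\<in>snd z. e \<subseteq> fst z" using z unfolding copies_def by force+
    show "(z \<in> copies VF EF n E \<and> b \<notin> snd z) \<or> (\<exists>X\<in>XX. card (fst z \<inter> X) \<ge> 3)"
    proof (cases "m \<in> snd z")
      case False
      then have "snd z \<subseteq> E - {b}" using zE by (auto simp: E'_def)
      then show ?thesis using z by (auto simp: copies_def)
    next
      case True
      obtain b' where b': "b' \<in> E' - turan_edges n p" "b' \<subseteq> fst z" using copy_has_bad_edge[OF p z] by blast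
      then have b'E: "b' \<in> E - turan_edges n p" "b' \<noteq> m" using m by (auto simp: E'_def)
      have "finite b' \<and> card b' = 2" using two E b'E by blast
      then have "\<not> b' \<subseteq> m" using m2 b'E(2) card_subset_eq[of m b'] by auto
      then have "card m < card (m \<union> b')" using m2 \<open>finite b' \<and> card b' = 2\<close> by (intro psubset_card_mono) auto
      moreover have "fst z \<inter> (m \<union> b') = m \<union> b'" using zE(2) True b' by auto
      ultimately have "card (fst z \<inter> (m \<union> b')) \<ge> 3" using m2 by simp
      then show ?thesis using b'E by (intro disjI2 bexI[of _ "m \<union> b'"]) (auto simp: XX_def)
    qed
  qed
  then show False using min[OF E' cE'] by simp
qed

lemma minimizer_balanced:
  fixes \<eta> :: real
  assumes E: "E \<subseteq> all_edges n" and n: "n > 0" and p: "\<forall>x<n. p x < r" and \<eta>: "\<eta> * 8 ^ card VF < kappa" "\<eta> < 1 / (4 * real r)"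
    and B: "real (card (E - turan_edges n p)) \<le> \<eta> * real n"
    and bad: "\<And>b. b \<in> E - turan_edges n p \<Longrightarrow>
      kappa * real n ^ (card VF - 2) \<le> real (card {z \<in> copies VF EF n E. b \<in> snd z})"
    and size: "\<And>i. i < r \<Longrightarrow> real n / (2 * real r) \<le> real (part_size n p i)"
    and K: "turan_edges n p \<subseteq> E" and cE: "card E \<ge> turan_number r n"
    and min: "\<And>E'. E' \<subseteq> all_edges n \<Longrightarrow> card E' = card E \<Longrightarrow> num_copies VF EF n E \<le> num_copies VF EF n E'"
    and ij: "i < r" "j < r"
  shows "part_size n p i \<le> Suc (part_size n p j)"
proof (rule ccontr)
  assume "\<not> ?thesis"
  then have big: "part_size n p i \<ge> part_size n p j + 2" by simp
  define B where "B = E - turan_edges n p"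
  have finE: "finite E" using E finite_all_edges finite_subset by blast
  have finB: "finite B" using finE by (simp add: B_def)
  note two = all_edges_card[of _ n]
  have Ball: "B \<subseteq> all_edges n" using E by (auto simp: B_def)
  \<comment> \<open>Bad edges cover at most 2 \<eta> n vertices, fewer than the n/(2r) in part i, so
    part i has a vertex without bad edges.\<close>
  have "card (\<Union>B) \<le> (\<Sum>b\<in>B. card b)" using card_Union_le_sum_card[of B] by simp
  also have "\<dots> = 2 * card B" using two Ball by (subst sum.cong[OF refl, of _ _ "\<lambda>_. 2"]) auto
  finally have "real (card (\<Union>B)) \<le> 2 * (\<eta> * real n)" using assms(6) unfolding B_def by linarith
  also have "\<dots> < 2 * (1 / (4 * real r) * real n)" using \<eta>(2) n by (intro mult_strict_left_mono mult_strict_right_mono) auto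
  also have "\<dots> = real n / (2 * real r)" by simp
  also have "\<dots> \<le> real (part_size n p i)" using size ij by simp
  finally have "card (\<Union>B) < card {x. x < n \<and> p x = i}" by (simp add: part_size_def)
  moreover have "finite (\<Union>B)" using finB two Ball by blast
  ultimately have "\<not> {x. x < n \<and> p x = i} \<subseteq> \<Union>B" using card_mono by (meson leD)
  then obtain v0 where v0: "v0 < n" "p v0 = i" "\<And>b. b \<in> B \<Longrightarrow> v0 \<notin> b" by blast
  define p' where "p' = p(v0 := j)"
  have p': "\<forall>x<n. p' x < r" using p ij by (simp add: p'_def)
  have gain: "card (turan_edges n p) < card (turan_edges n p')"
    unfolding p'_def by (rule card_turan_edges_move[OF p v0(1) ij(2) v0(2) big])
  have le: "card (turan_edges n p') \<le> turan_number r n" using card_turan_edges_le[OF _ p'] r by simp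
  have cE2: "card E = card (turan_edges n p) + card B"
    unfolding B_def using K finE finite_subset[OF K finE] by (simp add: card_Diff_subset card_mono)
  \<comment> \<open>The number of bad edges to keep. The subtraction is exact because the cross
    edges of \<open>p'\<close> number at most \<open>turan_number r n\<close>, and k < |B| because
    the move gains cross edges.\<close>
  define k where "k = card E - card (turan_edges n p')"
  have k: "k < card B" "card (turan_edges n p') + k = card E" using gain le cE cE2 by (auto simp: k_def)
  obtain B' where B': "B' \<subseteq> B" "card B' = k" "finite B'" using obtain_subset_with_card_n[of k B] k by auto
  obtain b where b: "b \<in> B" "b \<notin> B'" using B' k by (metis less_irrefl subset_antisym subsetI)
  have off: "e \<in> turan_edges n p' \<longleftrightarrow> e \<in> turan_edges n p" if e: "e \<in> all_edges n" "v0 \<notin> e" for e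
  proof -
    obtain x y where "e = {x, y}" using e(1) by (auto elim: all_edges_pairE)
    then show ?thesis using e(2) by (simp add: turan_edges_iff p'_def)
  qed
  have disj: "B \<inter> turan_edges n p' = {}" using off v0(3) Ball by (auto simp: B_def)
  define E' where "E' = turan_edges n p' \<union> B'"
  have E': "E' \<subseteq> all_edges n" using turan_edges_subset B' Ball by (auto simp: E'_def)
  have finK': "finite (turan_edges n p')" using turan_edges_subset finite_all_edges finite_subset by blast
  have cE': "card E' = card E"
    unfolding E'_def using finK' B' disj k by (subst card_Un_disjoint) auto
  define XX where "XX = insert v0 ` B"
  have "num_copies VF EF n E' < num_copies VF EF n E"
  proof (rule fewer_copies[OF E E' n bad \<eta>(1), of b XX])
    show "b \<in> E - turan_edges n p" using b by (simp add: B_def)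
    show "finite XX" using finB by (simp add: XX_def)
    have "card XX \<le> card B" unfolding XX_def using finB by (intro card_image_le) auto
    then show "real (card XX) \<le> \<eta> * real n" using assms(6) unfolding B_def by linarith
    show "finite X \<and> card X \<le> 4" if "X \<in> XX" for X
      using that two Ball by (auto simp: XX_def card_insert_if)
    fix z assume z: "z \<in> copies VF EF n E'"
    have zE: "snd z \<subseteq> E'" "\<forall>e\<in>snd z. e \<subseteq> fst z" using z unfolding copies_def by force+
    show "(z \<in> copies VF EF n E \<and> b \<notin> snd z) \<or> (\<exists>X\<in>XX. card (fst z \<inter> X) \<ge> 3)"
    proof (cases "\<exists>e\<in>snd z. v0 \<in> e")
      case False
      have "e \<in> E - {b}" if e: "e \<in> snd z" for e
      proof (cases "e \<in> B'")
        case True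
        then show ?thesis using B' b by (auto simp: B_def)
      next
        case nB: False
        have "e \<in> turan_edges n p'" using e zE nB by (auto simp: E'_def)
        moreover have "v0 \<notin> e" using False e by blast
        ultimately have "e \<in> turan_edges n p" using off turan_edges_subset by blast
        then show ?thesis using K b by (auto simp: B_def)
      qed
      then have "snd z \<subseteq> E - {b}" by blast
      then show ?thesis using z by (auto simp: copies_def)
    next
      case True
      then have v0z: "v0 \<in> fst z" using zE(2) by blast
      obtain b' where b': "b' \<in> E' - turan_edges n p'" "b' \<subseteq> fst z" using copy_has_bad_edge[OF p' z] by blast
      then have b'B: "b' \<in> B" using B' by (auto simp: E'_def)
      then have "v0 \<notin> b'" "finite b' \<and> card b' = 2" using v0(3) two Ball by blast+
      then have "card (insert v0 b') = 3" by simp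
      moreover have "fst z \<inter> insert v0 b' = insert v0 b'" using v0z b' by auto
      ultimately show ?thesis using b'B by (intro disjI2 bexI[of _ "insert v0 b'"]) (auto simp: XX_def)
    qed
  qed
  then show False using min[OF E' cE'] by simp
qed

end

section \<open>The extremal number and the comparison of hF with tF\<close>

lemma finite_F_free_cards: "finite {card E | E. F_free VF EF n E}"
  by (rule finite_subset[of _ "card ` Pow (all_edges n)"]) (auto simp: finite_all_edges F_free_def)

text \<open>By counting edges, the Turan graph inside a minimizer has exactly ex(n,F) edges; being
  F-free, it is a competitor for tF. Conversely every competitor for tF is one for hF.\<close>

lemma hF_eq_tF:
  assumes free: "\<And>p. \<forall>x<n. p x < r \<Longrightarrow> F_free VF EF n (turan_edges n p)"
    and ne: "HF VF EF n q \<noteq> {}" and sub: "HF VF EF n q \<subseteq> Tq r n q"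
  shows "hF VF EF n q = tF VF EF n q"
proof -
  define S where "S = {num_copies VF EF n (E \<union> A) | E A.
      F_free VF EF n E \<and> card E = ex n VF EF \<and> A \<subseteq> all_edges n - E \<and> card A = q}"
  have finS: "finite S"
    unfolding S_def
    by (rule finite_subset[of _ "num_copies VF EF n ` Pow (all_edges n)"]) (auto simp: finite_all_edges F_free_def)
  obtain E where E: "E \<in> HF VF EF n q" using ne by blast
  then obtain p A where pA: "balanced_partition r n p" "A \<subseteq> all_edges n - turan_edges n p" "card A = q"
    "E = turan_edges n p \<union> A" using sub by (auto simp: Tq_def)
  have p: "\<forall>x<n. p x < r" using pA by (simp add: balanced_partition_def)
  have E2: "E \<subseteq> all_edges n" "card E = ex n VF EF + q" "num_copies VF EF n E = hF VF EF n q"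
    using E by (auto simp: HF_def)
  have "finite E" using E2 finite_all_edges finite_subset by blast
  then have "card E = card (turan_edges n p) + card A"
    unfolding pA(4) using pA(2) by (intro card_Un_disjoint) auto
  then have "card (turan_edges n p) = ex n VF EF" using E2 pA by simp
  then have in_S: "hF VF EF n q \<in> S"
    unfolding S_def using free[OF p] pA E2(3) by (intro CollectI exI[of _ "turan_edges n p"] exI[of _ A]) auto
  have "hF VF EF n q \<le> s" if "s \<in> S" for s
  proof -
    obtain E' A' where s: "s = num_copies VF EF n (E' \<union> A')" "F_free VF EF n E'" "card E' = ex n VF EF"
      "A' \<subseteq> all_edges n - E'" "card A' = q" using \<open>s \<in> S\<close> by (auto simp: S_def)
    have sub': "E' \<subseteq> all_edges n" "A' \<subseteq> all_edges n" using s by (auto simp: F_free_def)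
    then have "finite E'" "finite A'" using finite_all_edges finite_subset by blast+
    then have "card (E' \<union> A') = ex n VF EF + q" using s by (subst card_Un_disjoint) auto
    then show ?thesis unfolding s(1) using sub' by (intro hF_le) auto
  qed
  then have "Min S = hF VF EF n q" using finS in_S by (intro Min_eqI) auto
  then show ?thesis by (simp add: tF_def S_def)
qed

context colour_critical
begin

lemma turan_F_free: "\<forall>x<n. p x < r \<Longrightarrow> F_free VF EF n (turan_edges n p)"
  using turan_copies_empty turan_edges_subset by (simp add: F_free_def)

text \<open>A larger F-free graph would contain one with exactly one edge more than the Turan
  number, still without copies. The structural lemma for q = 1 would apply to it, and some edge
  would be bad; but a bad edge lies in a positive number of copies.\<close>

lemma ex_eq_turan_number:
  assumes n: "n > 0"
    and bad: "\<And>E. E \<subseteq> all_edges n \<Longrightarrow> card E = turan_number r n + 1 \<Longrightarrow>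
       num_copies VF EF n E \<le> 8 ^ card VF * n ^ (card VF - 2) \<Longrightarrow>
       \<exists>p. (\<forall>x<n. p x < r) \<and> (\<forall>b\<in>E - turan_edges n p.
         kappa * real n ^ (card VF - 2) \<le> real (card {z \<in> copies VF EF n E. b \<in> snd z}))"
  shows "ex n VF EF = turan_number r n"
proof -
  have mod: "\<forall>x<n. x mod r < r" using r by auto
  have "card E \<le> turan_number r n" if free: "F_free VF EF n E" for E
  proof (rule ccontr)
    assume "\<not> ?thesis"
    then have "turan_number r n + 1 \<le> card E" by simp
    then obtain E1 where E1: "E1 \<subseteq> E" "card E1 = turan_number r n + 1"
      by (rule obtain_subset_with_card_n)
    have none: "copies VF EF n E1 = {}" using free copies_mono[OF E1(1), of VF EF n] unfolding F_free_def by blast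
    have E1a: "E1 \<subseteq> all_edges n" using E1 free by (auto simp: F_free_def)
    have "num_copies VF EF n E1 \<le> 8 ^ card VF * n ^ (card VF - 2)" by (simp add: num_copies_def none)
    then obtain p where p: "\<forall>x<n. p x < r" "\<forall>b\<in>E1 - turan_edges n p.
         kappa * real n ^ (card VF - 2) \<le> real (card {z \<in> copies VF EF n E1. b \<in> snd z})"
      using bad[OF E1a E1(2)] by meson
    have "card (turan_edges n p) \<le> turan_number r n" using card_turan_edges_le[OF _ p(1)] r by simp
    moreover have "finite (turan_edges n p)" using turan_edges_subset finite_all_edges finite_subset by blast
    ultimately have "\<not> E1 \<subseteq> turan_edges n p" using E1(2) card_mono[of "turan_edges n p" E1] by auto
    then obtain b where "b \<in> E1 - turan_edges n p" by blast
    then have "kappa * real n ^ (card VF - 2) \<le> 0" using p(2) none by auto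
    moreover have "kappa * real n ^ (card VF - 2) > 0" using kappa_pos n by simp
    ultimately show False by linarith
  qed
  moreover have "turan_number r n \<in> {card E | E. F_free VF EF n E}"
    using turan_F_free[OF mod] by (auto simp: turan_number_def)
  ultimately show ?thesis
    unfolding ex_def using finite_F_free_cards by (intro Max_eqI) auto
qed

lemma supersaturation:
  "\<exists>c1 :: real. c1 > 0 \<and> (\<exists>n0 :: nat. \<forall>n q. n > n0 \<and> 1 \<le> q \<and> real q < c1 * real n \<longrightarrow>
           hF VF EF n q = tF VF EF n q \<and> HF VF EF n q \<subseteq> Tq r n q)"
proof -
  \<comment> \<open>Half of each of the two strict upper bounds that the exchange lemmas impose on
    \<eta>.\<close>
  define \<eta> :: real where "\<eta> = min (kappa / (2 * 8 ^ card VF)) (1 / (8 * real r))"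
  have \<eta>: "\<eta> > 0" "\<eta> < 1 / (4 * real r)" using kappa_pos r by (auto simp: \<eta>_def min_less_iff_disj field_simps)
  have "\<eta> * 8 ^ card VF \<le> kappa / (2 * 8 ^ card VF) * 8 ^ card VF"
    by (intro mult_right_mono) (auto simp: \<eta>_def)
  also have "\<dots> < kappa" using kappa_pos by simp
  finally have \<eta>k: "\<eta> * 8 ^ card VF < kappa" .
  obtain c0 n1 where c0: "c0 > 0" and struct: "\<forall>n q E. n > n1 \<and> real q < c0 * real n \<and> E \<subseteq> all_edges n \<and>
    card E = turan_number r n + q \<and> num_copies VF EF n E \<le> 8 ^ card VF * q * n ^ (card VF - 2) \<longrightarrow>
    (\<exists>p. (\<forall>x<n. p x < r) \<and> (\<forall>i<r. real n / (2 * real r) \<le> real (part_size n p i)) \<and>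
      real (card (E - turan_edges n p)) \<le> \<eta> * real n \<and>
      (\<forall>b\<in>E - turan_edges n p. kappa * real n ^ (card VF - 2) \<le> real (card {z \<in> copies VF EF n E. b \<in> snd z})))"
    using near_turan_structure[OF \<eta>(1)] by (elim exE conjE)
  \<comment> \<open>The 1/2 gives 2q < n, and with n > 2r this yields q + r <= n, so enough pairs of
    equal residue exist.\<close>
  define c1 where "c1 = min c0 (1 / 2)"
  define n0 where "n0 = max n1 (2 * r)"
  have c1: "c1 > 0" "c1 \<le> c0" "c1 \<le> 1 / 2" using c0 by (auto simp: c1_def)
  show ?thesis
  proof (intro exI[of _ c1] conjI[OF c1(1)] exI[of _ n0] allI impI, elim conjE)
    fix n q :: nat assume n: "n > n0" and q1: "1 \<le> q" and q: "real q < c1 * real n"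
    have n': "n > n1" "n > 2 * r" "n > 0" using n by (auto simp: n0_def)
    have "c1 * real n \<le> c0 * real n" "c1 * real n \<le> 1 / 2 * real n"
      using c1 by (intro mult_right_mono; simp)+
    then have qc0: "real q < c0 * real n" and qn: "2 * q < n" using q by linarith+
    have mod: "\<forall>x<n. x mod r < r" using r by auto
    have ex: "ex n VF EF = turan_number r n"
    proof (rule ex_eq_turan_number[OF n'(3)])
      fix E assume a: "E \<subseteq> all_edges n" "card E = turan_number r n + 1"
       "num_copies VF EF n E \<le> 8 ^ card VF * n ^ (card VF - 2)"
      have "real 1 < c0 * real n" using qc0 q1 by simp
      then show "\<exists>p. (\<forall>x<n. p x < r) \<and> (\<forall>b\<in>E - turan_edges n p.
         kappa * real n ^ (card VF - 2) \<le> real (card {z \<in> copies VF EF n E. b \<in> snd z}))"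
        using struct[rule_format, of n 1 E] a n' by auto
    qed
    obtain A where A: "A \<subseteq> all_edges n - turan_edges n (\<lambda>v. v mod r)" "card A = q"
      using many_non_turan_edges[of r q n] r n' qn by auto
    define E0 where "E0 = turan_edges n (\<lambda>v. v mod r) \<union> A"
    have E0: "E0 \<subseteq> all_edges n" using A turan_edges_subset by (auto simp: E0_def)
    have "finite E0" using E0 finite_all_edges finite_subset by blast
    then have cE0: "card E0 = ex n VF EF + q"
      unfolding E0_def ex turan_number_def using A by (subst card_Un_disjoint) auto
    have few0: "num_copies VF EF n E0 \<le> 8 ^ card VF * q * n ^ (card VF - 2)"
      unfolding E0_def using few_copies_turan_plus[OF n'(3) mod A(1)] A(2) by simp
    have sub: "HF VF EF n q \<subseteq> Tq r n q"
    proof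
      fix E assume "E \<in> HF VF EF n q"
      then have E: "E \<subseteq> all_edges n" "card E = turan_number r n + q" "num_copies VF EF n E = hF VF EF n q"
        by (auto simp: HF_def ex)
      have min: "num_copies VF EF n E \<le> num_copies VF EF n E'" if "E' \<subseteq> all_edges n" "card E' = card E" for E'
        using hF_le[of E' n VF EF q] that E ex by simp
      have "num_copies VF EF n E \<le> 8 ^ card VF * q * n ^ (card VF - 2)"
        using min[OF E0] cE0 E ex few0 by simp
      then obtain p where p: "\<forall>x<n. p x < r"
        and size: "\<forall>i<r. real n / (2 * real r) \<le> real (part_size n p i)"
        and B: "real (card (E - turan_edges n p)) \<le> \<eta> * real n"
        and bad: "\<forall>b\<in>E - turan_edges n p. kappa * real n ^ (card VF - 2) \<le> real (card {z \<in> copies VF EF n E. b \<in> snd z})"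
        using struct[rule_format, of n q E] n' qc0 E by auto
      have finK: "finite (turan_edges n p)" using turan_edges_subset finite_all_edges finite_subset by blast
      have tur: "card (turan_edges n p) \<le> turan_number r n" using card_turan_edges_le[OF _ p] r by simp
      \<comment> \<open>Here q >= 1 enters: the exchanges need a bad edge to give up.\<close>
      have "E - turan_edges n p \<noteq> {}"
      proof
        assume "E - turan_edges n p = {}"
        then have "card E \<le> card (turan_edges n p)" using finK by (intro card_mono) auto
        then show False using tur E q1 by simp
      qed
      then have K: "turan_edges n p \<subseteq> E"
        using minimizer_complete[OF E(1) n'(3) p \<eta>k B] bad min by blast
      have close: "part_size n p i \<le> Suc (part_size n p j)" if "i < r" "j < r" for i j
        using E(2) size bad that min
        by (intro minimizer_balanced[OF E(1) n'(3) p \<eta>k \<eta>(2) B _ _ K]) auto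
      have parts: "part_size n p i \<in> {n div r, Suc (n div r)}" if "i < r" for i
        using part_size_near_equal[OF _ p close that] r by simp
      have "balanced_partition r n p" using balanced_partitionI[OF _ p parts] r by simp
      moreover have "card (turan_edges n p) = turan_number r n" using turan_number_eq[OF _ p parts] r by simp
      then have "card (E - turan_edges n p) = q" using E finK K by (simp add: card_Diff_subset)
      moreover have "E - turan_edges n p \<subseteq> all_edges n - turan_edges n p" "E = turan_edges n p \<union> (E - turan_edges n p)"
        using E(1) K by auto
      ultimately show "E \<in> Tq r n q" unfolding Tq_def by blast
    qed
    have "hF VF EF n q = tF VF EF n q"
      using hF_eq_tF[OF turan_F_free HF_nonempty[OF E0 cE0] sub] .
    then show "hF VF EF n q = tF VF EF n q \<and> HF VF EF n q \<subseteq> Tq r n q" using sub by simp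
  qed
qed

end

section \<open>From the chromatic number to a colouring\<close>

lemma colorable_card:
  assumes "graph V E" shows "colorable V E (card V)"
proof -
  have "finite V" using assms by (simp add: graph_def)
  then obtain h where h: "bij_betw h V {0..<card V}" using ex_bij_betw_finite_nat by blast
  have "h x \<noteq> h y" if "e \<in> E" "x \<in> e" "y \<in> e" "x \<noteq> y" for e x y
  proof -
    have "x \<in> V" "y \<in> V" using assms that by (auto simp: graph_def)
    then show ?thesis using h that by (auto simp: bij_betw_def inj_on_def)
  qed
  moreover have "h x < card V" if "x \<in> V" for x using h that by (auto simp: bij_betw_def)
  ultimately show ?thesis unfolding colorable_def by blast
qed

text \<open>\<open>LEAST\<close> is meaningful only once some colouring exists; an enumeration of
  the vertices is one.\<close>

lemma colorable_chi: "graph V E \<Longrightarrow> colorable V E (chi V E)"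
  unfolding chi_def by (rule LeastI) (rule colorable_card)

lemma chi_le: "colorable V E k \<Longrightarrow> chi V E \<le> k"
  unfolding chi_def by (rule Least_le)

lemma critical_colouring:
  assumes r: "r \<ge> 2" and F: "graph VF EF" and crit: "critical r VF EF"
  obtains c u v where "colour_critical VF EF r c u v"
proof -
  obtain e where e: "e \<in> EF" "chi VF (EF - {e}) = r" and chi: "chi VF EF = r + 1"
    using crit by (auto simp: critical_def)
  have "card e = 2" using F e by (simp add: graph_def)
  then obtain u v where uv: "e = {u, v}" "u \<noteq> v" by (auto simp: card_2_iff)
  have "graph VF (EF - {e})" using F by (simp add: graph_def)
  from colorable_chi[OF this] e(2) have "colorable VF (EF - {e}) r" by simp
  then obtain c where c: "\<forall>x\<in>VF. c x < r" "\<forall>e'\<in>EF - {e}. \<forall>x\<in>e'. \<forall>y\<in>e'. x \<noteq> y \<longrightarrow> c x \<noteq> c y"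
    unfolding colorable_def by blast
  have "colour_critical VF EF r c u v"
  proof
    show "c x < r" if "x \<in> VF" for x using c that by blast
    show "c x \<noteq> c y" if "{x, y} \<in> EF" "x \<noteq> y" "{x, y} \<noteq> {u, v}" for x y
      using c(2)[rule_format, of "{x, y}" x y] that uv(1) by simp
    show "\<not> colorable VF EF r" using chi_le[of VF EF r] chi by auto
    \<comment> \<open>At least chi = r + 1 vertices are needed, and r >= 2.\<close>
    show "card VF \<ge> 3" using chi_le[OF colorable_card[OF F]] chi r by simp
  qed (use r F e uv in auto)
  then show ?thesis by (rule that)
qed

theorem theorem2:
  fixes VF :: "'a set" and EF :: "'a set set" and r :: nat
  assumes "r \<ge> 2"
    and "graph VF EF"
    and "critical r VF EF"
  shows "\<exists>c1 :: real. c1 > 0 \<and> (\<exists>n0 :: nat. \<forall>n q. n > n0 \<and> 1 \<le> q \<and> real q < c1 * real n \<longrightarrow>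
           hF VF EF n q = tF VF EF n q \<and> HF VF EF n q \<subseteq> Tq r n q)"
proof -
  obtain c u v where "colour_critical VF EF r c u v"
    using critical_colouring[OF assms] .
  then show ?thesis by (rule colour_critical.supersaturation)
qed

end
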